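(* Let $R$ be a ring, $N$ an $R$-$R$-bimodule, $T_R(N)$ the tensor ring, $l=T_R(N)\otimes_R-:\operatorname{Mod}R\to\operatorname{Mod}T_R(N)$ and $q=R\otimes_{T_R(N)}-:\operatorname{Mod}T_R(N)\to\operatorname{Mod}R$. Let $(X,\alpha)$ be a left $T_R(N)$-module and $l(P_1)\xrightarrow{\delta}l(P_0)\to(X,\alpha)\to0$ a projective presentation of it, with $P_0,P_1$ projective left $R$-modules. If $(X,\alpha)$ is silting (respectively, partial silting) with respect to $\delta$, then $\operatorname{Coker}(\alpha)$ is a silting (respectively, partial silting) left $R$-module with respect to $q(\delta)$.
   Context: Rings are nonzero, associative with identity; modules are unitary; $\operatorname{Mod}R$ is the category of left $R$-modules. The tensor ring is $T_R(N)=\bigoplus_{i\ge0}N^{\otimes_R i}$ with $N^{\otimes_R 0}=R$ and multiplication given by concatenation of tensors. Put $M'=\bigoplus_{i\ge1}N^{\otimes_R i}$ and let $\theta:M'\otimes_RM'\to M'$ be induced by the canonical maps $N^{\otimes k}\otimes_RN^{\otimes j}\to N^{\otimes(k+j)}$. Then $T_R(N)\cong R\ltimes_\theta M'$, the ring with underlying group $R\oplus M'$ and product $(r,m)(r',m')=(rr',rm'+mr'+\theta(m\otimes m'))$. A left $T_R(N)$-module is identified with a pair $(X,\alpha)$, where $X$ is a left $R$-module and $\alpha:M'\otimes_RX\to X$ is an $R$-homomorphism with $\alpha\circ(1_{M'}\otimes\alpha)=\alpha\circ(\theta\otimes1_X)$. The inclusion $R\to T_R(N)$ and the projection $T_R(N)\to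 R$ (killing $M'$) make $T_R(N)$ a $T_R(N)$-$R$-bimodule and $R$ an $R$-$T_R(N)$-bimodule. One has $q(X,\alpha)=\operatorname{Coker}\alpha$ and $ql\simeq\mathrm{Id}$, so $q(\delta)$ is regarded as a map $P_1\to P_0$ giving the projective presentation $P_1\xrightarrow{q(\delta)}P_0\to\operatorname{Coker}\alpha\to0$. For a morphism $\sigma:X\to Z$ of left modules over a ring, $\mathcal{D}_\sigma$ is the class of modules $L$ such that $\operatorname{Hom}(\sigma,L):\operatorname{Hom}(Z,L)\to\operatorname{Hom}(X,L)$ is surjective. $\operatorname{Gen}(X)$ is the class of quotients of direct sums of copies of $X$. Given a projective presentation $Q_1\xrightarrow{\sigma}Q_0\to X\to0$ (exact, $Q_0,Q_1$ projective), $X$ is partial silting with respect to $\sigma$ if $X\in\mathcal{D}_\sigma$ and $\mathcal{D}_\sigma$ is a torsion class (equivalently, closed under direct sums); $X$ is silting with respect to $\sigma$ if $\operatorname{Gen}(X)=\mathcal{D}_\sigma$. *)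

theory Defs
  imports "HOL-Algebra.AbelCoset" "HOL-Algebra.Module" "HOL-Algebra.Free_Abelian_Groups"
begin

section \<open>Modules over a noncommutative ring\<close>

text \<open>The library's locale \<open>module\<close> assumes a commutative ring, so only its record type is used.
  The fields \<open>mult\<close> and \<open>one\<close>, which that record inherits from rings, carry no meaning here.\<close>

locale left_module = R?: ring R + M?: abelian_group M
  for R :: "('r, 'k) ring_scheme" (structure) and M :: "('r, 'm, 'z) module_scheme" (structure) +
  assumes lsmult_closed:
      "\<lbrakk>a \<in> carrier R; x \<in> carrier M\<rbrakk> \<Longrightarrow> a \<odot>\<^bsub>M\<^esub> x \<in> carrier M"
    and lsmult_l_distr:
      "\<lbrakk>a \<in> carrier R; b \<in> carrier R; x \<in> carrier M\<rbrakk>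
        \<Longrightarrow> (a \<oplus>\<^bsub>R\<^esub> b) \<odot>\<^bsub>M\<^esub> x = a \<odot>\<^bsub>M\<^esub> x \<oplus>\<^bsub>M\<^esub> b \<odot>\<^bsub>M\<^esub> x"
    and lsmult_r_distr:
      "\<lbrakk>a \<in> carrier R; x \<in> carrier M; y \<in> carrier M\<rbrakk>
        \<Longrightarrow> a \<odot>\<^bsub>M\<^esub> (x \<oplus>\<^bsub>M\<^esub> y) = a \<odot>\<^bsub>M\<^esub> x \<oplus>\<^bsub>M\<^esub> a \<odot>\<^bsub>M\<^esub> y"
    and lsmult_assoc:
      "\<lbrakk>a \<in> carrier R; b \<in> carrier R; x \<in> carrier M\<rbrakk>
        \<Longrightarrow> (a \<otimes>\<^bsub>R\<^esub> b) \<odot>\<^bsub>M\<^esub> x = a \<odot>\<^bsub>M\<^esub> (b \<odot>\<^bsub>M\<^esub> x)"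
    and lsmult_one:
      "x \<in> carrier M \<Longrightarrow> \<one>\<^bsub>R\<^esub> \<odot>\<^bsub>M\<^esub> x = x"

record ('s, 'r, 'm) bimodule = "('s, 'm) module" +
  rsmult :: "'m \<Rightarrow> 'r \<Rightarrow> 'm"

locale bimodule = left_module S M + right: ring R
  for S :: "('s, 'k) ring_scheme" and R :: "('r, 'l) ring_scheme"
    and M :: "('s, 'r, 'm, 'z) bimodule_scheme" +
  assumes rsmult_closed:
      "\<lbrakk>x \<in> carrier M; a \<in> carrier R\<rbrakk> \<Longrightarrow> rsmult M x a \<in> carrier M"
    and rsmult_l_distr:
      "\<lbrakk>x \<in> carrier M; y \<in> carrier M; a \<in> carrier R\<rbrakk>
        \<Longrightarrow> rsmult M (x \<oplus>\<^bsub>M\<^esub> y) a = rsmult M x a \<oplus>\<^bsub>M\<^esub> rsmult M y a"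
    and rsmult_r_distr:
      "\<lbrakk>x \<in> carrier M; a \<in> carrier R; b \<in> carrier R\<rbrakk>
        \<Longrightarrow> rsmult M x (a \<oplus>\<^bsub>R\<^esub> b) = rsmult M x a \<oplus>\<^bsub>M\<^esub> rsmult M x b"
    and rsmult_assoc:
      "\<lbrakk>x \<in> carrier M; a \<in> carrier R; b \<in> carrier R\<rbrakk>
        \<Longrightarrow> rsmult M x (a \<otimes>\<^bsub>R\<^esub> b) = rsmult M (rsmult M x a) b"
    and rsmult_one:
      "x \<in> carrier M \<Longrightarrow> rsmult M x \<one>\<^bsub>R\<^esub> = x"
    and smult_rsmult:
      "\<lbrakk>s \<in> carrier S; x \<in> carrier M; a \<in> carrier R\<rbrakk>
        \<Longrightarrow> rsmult M (s \<odot>\<^bsub>M\<^esub> x) a = s \<odot>\<^bsub>M\<^esub> rsmult M x a"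

text \<open>Homomorphisms are constrained on the carrier only; their values elsewhere are arbitrary.\<close>

definition lmod_hom ::
  "('r, 'k) ring_scheme \<Rightarrow> ('r, 'a, 'y) module_scheme \<Rightarrow> ('r, 'b, 'z) module_scheme \<Rightarrow> ('a \<Rightarrow> 'b) set"
  where "lmod_hom R A B = {h \<in> carrier A \<rightarrow> carrier B.
    (\<forall>x\<in>carrier A. \<forall>y\<in>carrier A. h (x \<oplus>\<^bsub>A\<^esub> y) = h x \<oplus>\<^bsub>B\<^esub> h y) \<and>
    (\<forall>r\<in>carrier R. \<forall>x\<in>carrier A. h (r \<odot>\<^bsub>A\<^esub> x) = r \<odot>\<^bsub>B\<^esub> h x)}"

definition regular_module :: "('r, 'k) ring_scheme \<Rightarrow> ('r, 'r) module"
  where "regular_module R = \<lparr>carrier = carrier R, monoid.mult = undefined, one = undefined,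
    ring.zero = \<zero>\<^bsub>R\<^esub>, ring.add = ring.add R, smult = monoid.mult R\<rparr>"

definition dsum :: "'i set \<Rightarrow> ('i \<Rightarrow> ('r, 'm, 'z) module_scheme) \<Rightarrow> ('r, 'i \<Rightarrow> 'm) module"
  where "dsum I F = \<lparr>
    carrier = {f \<in> \<Pi>\<^sub>E i\<in>I. carrier (F i). finite {i \<in> I. f i \<noteq> \<zero>\<^bsub>F i\<^esub>}},
    monoid.mult = undefined, one = undefined,
    ring.zero = (\<lambda>i\<in>I. \<zero>\<^bsub>F i\<^esub>),
    ring.add = (\<lambda>f g. \<lambda>i\<in>I. f i \<oplus>\<^bsub>F i\<^esub> g i),
    smult = (\<lambda>r f. \<lambda>i\<in>I. r \<odot>\<^bsub>F i\<^esub> f i)\<rparr>"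

definition quot_module :: "('r, 'm, 'z) module_scheme \<Rightarrow> 'm set \<Rightarrow> ('r, 'm set) module"
  where "quot_module M B = \<lparr>
    carrier = a_rcosets\<^bsub>M\<^esub> B,
    monoid.mult = undefined, one = undefined,
    ring.zero = B,
    ring.add = set_add M,
    smult = (\<lambda>r C. \<Union>x\<in>C. B +>\<^bsub>M\<^esub> (r \<odot>\<^bsub>M\<^esub> x))\<rparr>"

text \<open>Projective means direct summand of a free module. A summand of any free module is a retract
  of the free module on its own elements, so index sets inside the type \<open>'p\<close> suffice.\<close>

definition projective_module :: "('r, 'k) ring_scheme \<Rightarrow> ('r, 'p) module \<Rightarrow> bool"
  where "projective_module R P \<longleftrightarrow> left_module R P \<and>
    (\<exists>I :: 'p set. \<exists>s \<in> lmod_hom R P (dsum I (\<lambda>_. regular_module R)).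
      \<exists>p \<in> lmod_hom R (dsum I (\<lambda>_. regular_module R)) P. \<forall>x\<in>carrier P. p (s x) = x)"


section \<open>Silting modules\<close>

text \<open>
  A class of left modules is a set of modules whose carriers lie in a type \<open>'u\<close>, which plays the
  role of the universe; every notion below that involves a class of modules is relative to \<open>'u\<close>.
  The type is arbitrary and is never required to be large, and the modules in the presentation
  need not live in it. Hence a theorem stated with a free type variable \<open>'u\<close> covers modules of
  every size.
\<close>

definition D_class :: "('r, 'k) ring_scheme \<Rightarrow> ('r, 'a) module \<Rightarrow> ('a \<Rightarrow> 'b) \<Rightarrow> ('r, 'b) module
    \<Rightarrow> ('r, 'u) module set"
  where "D_class R X \<sigma> Z = {L. left_module R L \<and>
    (\<forall>f \<in> lmod_hom R X L. \<exists>g \<in> lmod_hom R Z L. \<forall>x\<in>carrier X. g (\<sigma> x) = f x)}"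

text \<open>An epimorphism onto \<open>L\<close> from a direct sum of copies of \<open>X\<close> consists of a family of
  homomorphisms from \<open>X\<close> to \<open>L\<close>, in which repetitions are redundant; hence index sets of maps
  \<open>'x \<Rightarrow> 'u\<close> suffice.\<close>

definition Gen :: "('r, 'k) ring_scheme \<Rightarrow> ('r, 'x) module \<Rightarrow> ('r, 'u) module set"
  where "Gen R X = {L. left_module R L \<and>
    (\<exists>I :: ('x \<Rightarrow> 'u) set. \<exists>p \<in> lmod_hom R (dsum I (\<lambda>_. X)) L.
      p ` carrier (dsum I (\<lambda>_. X)) = carrier L)}"

text \<open>Closure under quotients, extensions and direct sums. If the direct sum of a family is
  isomorphic to a module in the universe \<open>'u\<close>, then its nonzero members can be indexed by elements
  of \<open>'u\<close>.\<close>

definition torsion_class :: "('r, 'k) ring_scheme \<Rightarrow> ('r, 'u) module set \<Rightarrow> bool"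
  where "torsion_class R \<C> \<longleftrightarrow>
    (\<forall>L\<in>\<C>. left_module R L) \<and>
    (\<forall>L\<in>\<C>. \<forall>L'. \<forall>p. left_module R L' \<and> p \<in> lmod_hom R L L' \<and> p ` carrier L = carrier L'
      \<longrightarrow> L' \<in> \<C>) \<and>
    (\<forall>A\<in>\<C>. \<forall>C\<in>\<C>. \<forall>B. \<forall>i. \<forall>p. left_module R B \<and>
      i \<in> lmod_hom R A B \<and> inj_on i (carrier A) \<and>
      p \<in> lmod_hom R B C \<and> p ` carrier B = carrier C \<and>
      i ` carrier A = {b \<in> carrier B. p b = \<zero>\<^bsub>C\<^esub>}
      \<longrightarrow> B \<in> \<C>) \<and>
    (\<forall>I :: 'u set. \<forall>F. \<forall>L. \<forall>h. (\<forall>i\<in>I. F i \<in> \<C>) \<and> left_module R L \<and>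
      h \<in> lmod_hom R (dsum I F) L \<and> bij_betw h (carrier (dsum I F)) (carrier L)
      \<longrightarrow> L \<in> \<C>)"

definition proj_presentation :: "('r, 'k) ring_scheme \<Rightarrow> ('r, 'a) module \<Rightarrow> ('a \<Rightarrow> 'b)
    \<Rightarrow> ('r, 'b) module \<Rightarrow> ('b \<Rightarrow> 'x) \<Rightarrow> ('r, 'x) module \<Rightarrow> bool"
  where "proj_presentation R Q1 \<sigma> Q0 \<pi> X \<longleftrightarrow>
    projective_module R Q1 \<and> projective_module R Q0 \<and> left_module R X \<and>
    \<sigma> \<in> lmod_hom R Q1 Q0 \<and> \<pi> \<in> lmod_hom R Q0 X \<and>
    \<pi> ` carrier Q0 = carrier X \<and>
    \<sigma> ` carrier Q1 = {x \<in> carrier Q0. \<pi> x = \<zero>\<^bsub>X\<^esub>}"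

definition silting :: "'u itself \<Rightarrow> ('r, 'k) ring_scheme \<Rightarrow> ('r, 'a) module \<Rightarrow> ('a \<Rightarrow> 'b)
    \<Rightarrow> ('r, 'b) module \<Rightarrow> ('r, 'x) module \<Rightarrow> bool"
  where "silting (_ :: 'u itself) R Q1 \<sigma> Q0 X \<longleftrightarrow>
    (\<exists>\<pi>. proj_presentation R Q1 \<sigma> Q0 \<pi> X) \<and>
    (Gen R X :: ('r, 'u) module set) = D_class R Q1 \<sigma> Q0"

definition partial_silting :: "'u itself \<Rightarrow> ('r, 'k) ring_scheme \<Rightarrow> ('r, 'a) module \<Rightarrow> ('a \<Rightarrow> 'b)
    \<Rightarrow> ('r, 'b) module \<Rightarrow> ('r, 'x) module \<Rightarrow> bool"
  where "partial_silting (_ :: 'u itself) R Q1 \<sigma> Q0 X \<longleftrightarrow>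
    (\<exists>\<pi>. proj_presentation R Q1 \<sigma> Q0 \<pi> X) \<and>
    X \<in> D_class R Q1 \<sigma> Q0 \<and>
    torsion_class R (D_class R Q1 \<sigma> Q0 :: ('r, 'u) module set)"


section \<open>Tensor products\<close>

text \<open>Abelian groups presented by generators \<open>S\<close> and relators \<open>rels\<close>; elements are cosets in the
  free abelian group on \<open>S\<close>.\<close>

type_synonym 'g pres = "('g \<Rightarrow>\<^sub>0 int) set"

definition pres_relgp :: "'g set \<Rightarrow> ('g \<Rightarrow>\<^sub>0 int) set \<Rightarrow> 'g pres"
  where "pres_relgp S rels = generate (free_Abelian_group S) rels"

definition pres_group :: "'g set \<Rightarrow> ('g \<Rightarrow>\<^sub>0 int) set \<Rightarrow> 'g pres monoid"
  where "pres_group S rels = free_Abelian_group S Mod pres_relgp S rels"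

definition pres_class :: "'g set \<Rightarrow> ('g \<Rightarrow>\<^sub>0 int) set \<Rightarrow> ('g \<Rightarrow>\<^sub>0 int) \<Rightarrow> 'g pres"
  where "pres_class S rels f = pres_relgp S rels #>\<^bsub>free_Abelian_group S\<^esub> f"

text \<open>The map into the group presented by \<open>S\<close> and \<open>rels\<close> that sends the class of each generator
  \<open>x\<close> to the class of \<open>\<phi> x\<close>. Whenever it is well defined, all members of the union coincide.\<close>

definition pres_map :: "'h set \<Rightarrow> ('h \<Rightarrow>\<^sub>0 int) set \<Rightarrow> ('g \<Rightarrow> 'h) \<Rightarrow> 'g pres \<Rightarrow> 'h pres"
  where "pres_map S rels \<phi> c = (\<Union>f\<in>c. pres_class S rels (frag_extend (\<lambda>x. frag_of (\<phi> x)) f))"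

definition tensor_rels :: "('r, 'k) ring_scheme \<Rightarrow> ('s, 'r, 'm, 'y) bimodule_scheme
    \<Rightarrow> ('r, 'x, 'z) module_scheme \<Rightarrow> ('m \<times> 'x \<Rightarrow>\<^sub>0 int) set"
  where "tensor_rels R M X =
    {frag_of (m \<oplus>\<^bsub>M\<^esub> m', x) - frag_of (m, x) - frag_of (m', x) | m m' x.
       m \<in> carrier M \<and> m' \<in> carrier M \<and> x \<in> carrier X} \<union>
    {frag_of (m, x \<oplus>\<^bsub>X\<^esub> x') - frag_of (m, x) - frag_of (m, x') | m x x'.
       m \<in> carrier M \<and> x \<in> carrier X \<and> x' \<in> carrier X} \<union>
    {frag_of (rsmult M m r, x) - frag_of (m, r \<odot>\<^bsub>X\<^esub> x) | m r x.
       m \<in> carrier M \<and> r \<in> carrier R \<and> x \<in> carrier X}"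

definition pure_tensor :: "('r, 'k) ring_scheme \<Rightarrow> ('s, 'r, 'm, 'y) bimodule_scheme
    \<Rightarrow> ('r, 'x, 'z) module_scheme \<Rightarrow> 'm \<Rightarrow> 'x \<Rightarrow> ('m \<times> 'x) pres"
  where "pure_tensor R M X m x =
    pres_class (carrier M \<times> carrier X) (tensor_rels R M X) (frag_of (m, x))"

text \<open>\<open>M \<otimes>\<^sub>R X\<close> for an \<open>S\<close>-\<open>R\<close>-bimodule \<open>M\<close>, as a left \<open>S\<close>-module.\<close>

definition tensor :: "('r, 'k) ring_scheme \<Rightarrow> ('s, 'r, 'm, 'y) bimodule_scheme
    \<Rightarrow> ('r, 'x, 'z) module_scheme \<Rightarrow> ('s, ('m \<times> 'x) pres) module"
  where "tensor R M X = (let S = carrier M \<times> carrier X; rels = tensor_rels R M X in \<lparr>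
    carrier = carrier (pres_group S rels),
    monoid.mult = undefined, one = undefined,
    ring.zero = \<one>\<^bsub>pres_group S rels\<^esub>,
    ring.add = monoid.mult (pres_group S rels),
    smult = (\<lambda>s. pres_map S rels (\<lambda>(m, x). (s \<odot>\<^bsub>M\<^esub> m, x)))\<rparr>)"

text \<open>\<open>1\<^sub>M \<otimes> h\<close>, where \<open>Y\<close> is the codomain of \<open>h\<close>.\<close>

definition tensor_map :: "('r, 'k) ring_scheme \<Rightarrow> ('s, 'r, 'm, 'y) bimodule_scheme
    \<Rightarrow> ('r, 'b, 'z) module_scheme \<Rightarrow> ('a \<Rightarrow> 'b) \<Rightarrow> ('m \<times> 'a) pres \<Rightarrow> ('m \<times> 'b) pres"
  where "tensor_map R M Y h =
    pres_map (carrier M \<times> carrier Y) (tensor_rels R M Y) (\<lambda>(m, x). (m, h x))"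


section \<open>The tensor ring\<close>

text \<open>Iterating the binary tensor product changes the type at every step. The power \<open>N\<^sup>\<otimes>\<^sup>n\<close>,
  \<open>n \<ge> 1\<close>, is therefore presented at once by all words of length \<open>n\<close> over \<open>N\<close>, subject to
  additivity in every letter and balancedness over \<open>R\<close> between adjacent letters.\<close>

definition words :: "('r, 'r, 'n, 'y) bimodule_scheme \<Rightarrow> nat \<Rightarrow> 'n list set"
  where "words N n = {w. set w \<subseteq> carrier N \<and> length w = n}"

definition tpow_rels :: "('r, 'k) ring_scheme \<Rightarrow> ('r, 'r, 'n, 'y) bimodule_scheme \<Rightarrow> nat
    \<Rightarrow> ('n list \<Rightarrow>\<^sub>0 int) set"
  where "tpow_rels R N n =
    {frag_of (u @ [x \<oplus>\<^bsub>N\<^esub> y] @ v) - frag_of (u @ [x] @ v) - frag_of (u @ [y] @ v) | u v x y.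
       u @ [x] @ v \<in> words N n \<and> y \<in> carrier N} \<union>
    {frag_of (u @ [rsmult N x r, y] @ v) - frag_of (u @ [x, r \<odot>\<^bsub>N\<^esub> y] @ v) | u v x y r.
       u @ [x, y] @ v \<in> words N n \<and> r \<in> carrier R}"

definition tpow :: "('r, 'k) ring_scheme \<Rightarrow> ('r, 'r, 'n, 'y) bimodule_scheme \<Rightarrow> nat
    \<Rightarrow> ('r, 'r, 'n list pres) bimodule"
  where "tpow R N n = (let S = words N n; rels = tpow_rels R N n in \<lparr>
    carrier = carrier (pres_group S rels),
    monoid.mult = undefined, one = undefined,
    ring.zero = \<one>\<^bsub>pres_group S rels\<^esub>,
    ring.add = monoid.mult (pres_group S rels),
    smult = (\<lambda>r. pres_map S rels (\<lambda>w. (r \<odot>\<^bsub>N\<^esub> hd w) # tl w)),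
    rsmult = (\<lambda>c r. pres_map S rels (\<lambda>w. butlast w @ [rsmult N (last w) r]) c)\<rparr>)"

text \<open>The canonical map \<open>N\<^sup>\<otimes>\<^sup>k \<times> N\<^sup>\<otimes>\<^sup>j \<rightarrow> N\<^sup>\<otimes>\<^sup>k\<^sup>+\<^sup>j\<close>, with the same convention as \<^const>\<open>pres_map\<close>.\<close>

definition tconcat :: "('r, 'k) ring_scheme \<Rightarrow> ('r, 'r, 'n, 'y) bimodule_scheme \<Rightarrow> nat \<Rightarrow> nat
    \<Rightarrow> 'n list pres \<Rightarrow> 'n list pres \<Rightarrow> 'n list pres"
  where "tconcat R N k j c d = (\<Union>f\<in>c. \<Union>g\<in>d.
    pres_class (words N (k + j)) (tpow_rels R N (k + j))
      (frag_extend (\<lambda>u. frag_extend (\<lambda>v. frag_of (u @ v)) g) f))"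

text \<open>\<open>M' = \<Oplus>\<^sub>n\<^sub>\<ge>\<^sub>1 N\<^sup>\<otimes>\<^sup>n\<close>\<close>

definition tplus :: "('r, 'k) ring_scheme \<Rightarrow> ('r, 'r, 'n, 'y) bimodule_scheme
    \<Rightarrow> ('r, 'r, nat \<Rightarrow> 'n list pres) bimodule"
  where "tplus R N = module.extend (dsum {1..} (tpow R N))
    (bimodule.fields (\<lambda>m r. \<lambda>n\<in>{1..}. rsmult (tpow R N n) (m n) r))"

text \<open>\<open>\<theta>(m \<otimes> m')\<close>, given as the corresponding balanced biadditive map.\<close>

definition theta :: "('r, 'k) ring_scheme \<Rightarrow> ('r, 'r, 'n, 'y) bimodule_scheme
    \<Rightarrow> (nat \<Rightarrow> 'n list pres) \<Rightarrow> (nat \<Rightarrow> 'n list pres) \<Rightarrow> (nat \<Rightarrow> 'n list pres)"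
  where "theta R N m m' = (\<lambda>n\<in>{1..}.
    \<Oplus>\<^bsub>tpow R N n\<^esub>k\<in>{1..<n}. tconcat R N k (n - k) (m k) (m' (n - k)))"

text \<open>The degree \<open>0\<close> part \<open>N\<^sup>\<otimes>\<^sup>0 = R\<close> has a type of its own, so that \<open>\<Oplus>\<^sub>n\<^sub>\<ge>\<^sub>0 N\<^sup>\<otimes>\<^sup>n\<close> is rendered as
  \<open>R \<times> M'\<close>.\<close>

definition tensor_ring :: "('r, 'k) ring_scheme \<Rightarrow> ('r, 'r, 'n, 'y) bimodule_scheme
    \<Rightarrow> ('r \<times> (nat \<Rightarrow> 'n list pres)) ring"
  where "tensor_ring R N = (let M = tplus R N in \<lparr>
    carrier = carrier R \<times> carrier M,
    monoid.mult = (\<lambda>(r, m) (r', m').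
      (r \<otimes>\<^bsub>R\<^esub> r', (r \<odot>\<^bsub>M\<^esub> m' \<oplus>\<^bsub>M\<^esub> rsmult M m r') \<oplus>\<^bsub>M\<^esub> theta R N m m')),
    one = (\<one>\<^bsub>R\<^esub>, \<zero>\<^bsub>M\<^esub>),
    ring.zero = (\<zero>\<^bsub>R\<^esub>, \<zero>\<^bsub>M\<^esub>),
    ring.add = (\<lambda>(r, m) (r', m'). (r \<oplus>\<^bsub>R\<^esub> r', m \<oplus>\<^bsub>M\<^esub> m'))\<rparr>)"


section \<open>Modules over the tensor ring\<close>

text \<open>Pairs \<open>(X, \<alpha>)\<close>; the identity \<open>\<alpha> \<circ> (1 \<otimes> \<alpha>) = \<alpha> \<circ> (\<theta> \<otimes> 1)\<close> between maps
  \<open>M' \<otimes> M' \<otimes> X \<rightarrow> X\<close> is stated on pure tensors.\<close>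

definition tr_pair :: "('r, 'k) ring_scheme \<Rightarrow> ('r, 'r, 'n, 'y) bimodule_scheme
    \<Rightarrow> ('r, 'x) module \<Rightarrow> (((nat \<Rightarrow> 'n list pres) \<times> 'x) pres \<Rightarrow> 'x) \<Rightarrow> bool"
  where "tr_pair R N X \<alpha> \<longleftrightarrow> left_module R X \<and> \<alpha> \<in> lmod_hom R (tensor R (tplus R N) X) X \<and>
    (\<forall>m\<in>carrier (tplus R N). \<forall>m'\<in>carrier (tplus R N). \<forall>x\<in>carrier X.
      \<alpha> (pure_tensor R (tplus R N) X m (\<alpha> (pure_tensor R (tplus R N) X m' x)))
      = \<alpha> (pure_tensor R (tplus R N) X (theta R N m m') x))"

definition tr_module :: "('r, 'k) ring_scheme \<Rightarrow> ('r, 'r, 'n, 'y) bimodule_scheme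
    \<Rightarrow> ('r, 'x) module \<Rightarrow> (((nat \<Rightarrow> 'n list pres) \<times> 'x) pres \<Rightarrow> 'x)
    \<Rightarrow> ('r \<times> (nat \<Rightarrow> 'n list pres), 'x) module"
  where "tr_module R N X \<alpha> = \<lparr>carrier = carrier X, monoid.mult = undefined, one = undefined,
    ring.zero = \<zero>\<^bsub>X\<^esub>, ring.add = ring.add X,
    smult = (\<lambda>(r, m) x. r \<odot>\<^bsub>X\<^esub> x \<oplus>\<^bsub>X\<^esub> \<alpha> (pure_tensor R (tplus R N) X m x))\<rparr>"

definition coker :: "('r, 'k) ring_scheme \<Rightarrow> ('r, 'r, 'n, 'y) bimodule_scheme
    \<Rightarrow> ('r, 'x) module \<Rightarrow> (((nat \<Rightarrow> 'n list pres) \<times> 'x) pres \<Rightarrow> 'x) \<Rightarrow> ('r, 'x set) module"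
  where "coker R N X \<alpha> = quot_module X (\<alpha> ` carrier (tensor R (tplus R N) X))"

text \<open>\<open>T\<^sub>R(N)\<close> as a \<open>T\<^sub>R(N)\<close>-\<open>R\<close>-bimodule, and \<open>R\<close> as an \<open>R\<close>-\<open>T\<^sub>R(N)\<close>-bimodule.\<close>

definition tr_bimodule :: "('r, 'k) ring_scheme \<Rightarrow> ('r, 'r, 'n, 'y) bimodule_scheme
    \<Rightarrow> ('r \<times> (nat \<Rightarrow> 'n list pres), 'r, 'r \<times> (nat \<Rightarrow> 'n list pres)) bimodule"
  where "tr_bimodule R N = module.extend (regular_module (tensor_ring R N))
    (bimodule.fields (\<lambda>t r. t \<otimes>\<^bsub>tensor_ring R N\<^esub> (r, \<zero>\<^bsub>tplus R N\<^esub>)))"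

definition aug_bimodule :: "('r, 'k) ring_scheme
    \<Rightarrow> ('r, 'r \<times> (nat \<Rightarrow> 'n list pres), 'r) bimodule"
  where "aug_bimodule R = module.extend (regular_module R)
    (bimodule.fields (\<lambda>r t. r \<otimes>\<^bsub>R\<^esub> fst t))"

definition l_obj :: "('r, 'k) ring_scheme \<Rightarrow> ('r, 'r, 'n, 'y) bimodule_scheme \<Rightarrow> ('r, 'p) module
    \<Rightarrow> ('r \<times> (nat \<Rightarrow> 'n list pres), (('r \<times> (nat \<Rightarrow> 'n list pres)) \<times> 'p) pres) module"
  where "l_obj R N P = tensor R (tr_bimodule R N) P"

definition q_obj :: "('r, 'k) ring_scheme \<Rightarrow> ('r, 'r, 'n, 'y) bimodule_scheme
    \<Rightarrow> ('r \<times> (nat \<Rightarrow> 'n list pres), 'a) module \<Rightarrow> ('r, ('r \<times> 'a) pres) module"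
  where "q_obj R N Y = tensor (tensor_ring R N) (aug_bimodule R) Y"

definition q_map :: "('r, 'k) ring_scheme \<Rightarrow> ('r, 'r, 'n, 'y) bimodule_scheme
    \<Rightarrow> ('r \<times> (nat \<Rightarrow> 'n list pres), 'b) module \<Rightarrow> ('a \<Rightarrow> 'b) \<Rightarrow> ('r \<times> 'a) pres \<Rightarrow> ('r \<times> 'b) pres"
  where "q_map R N Y h = tensor_map (tensor_ring R N) (aug_bimodule R) Y h"

text \<open>The natural isomorphism \<open>P \<rightarrow> q (l P)\<close>, \<open>p \<mapsto> 1 \<otimes> (1 \<otimes> p)\<close>.\<close>

definition ql_iso :: "('r, 'k) ring_scheme \<Rightarrow> ('r, 'r, 'n, 'y) bimodule_scheme \<Rightarrow> ('r, 'p) module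
    \<Rightarrow> 'p \<Rightarrow> ('r \<times> (('r \<times> (nat \<Rightarrow> 'n list pres)) \<times> 'p) pres) pres"
  where "ql_iso R N P p =
    pure_tensor (tensor_ring R N) (aug_bimodule R) (l_obj R N P) \<one>\<^bsub>R\<^esub>
      (pure_tensor R (tr_bimodule R N) P \<one>\<^bsub>tensor_ring R N\<^esub> p)"

text \<open>\<open>q(\<delta>)\<close> transported along \<^const>\<open>ql_iso\<close> to a map \<open>P1 \<rightarrow> P0\<close>.\<close>

definition q_delta :: "('r, 'k) ring_scheme \<Rightarrow> ('r, 'r, 'n, 'y) bimodule_scheme
    \<Rightarrow> ('r, 'a) module \<Rightarrow> ('r, 'b) module
    \<Rightarrow> ((('r \<times> (nat \<Rightarrow> 'n list pres)) \<times> 'a) pres \<Rightarrow> (('r \<times> (nat \<Rightarrow> 'n list pres)) \<times> 'b) pres)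
    \<Rightarrow> 'a \<Rightarrow> 'b"
  where "q_delta R N P1 P0 \<delta> p =
    inv_into (carrier P0) (ql_iso R N P0) (q_map R N (l_obj R N P0) \<delta> (ql_iso R N P1 p))"

end

theory Submission
  imports Defs
begin

text \<open>
  Along the augmentation \<open>T\<^sub>R(N) \<rightarrow> R\<close> every \<open>R\<close>-module \<open>L\<close> becomes a \<open>T\<^sub>R(N)\<close>-module, its inflation, with the
  same carrier. Since \<open>Hom\<^sub>T(l P, L) = Hom\<^sub>R(P, L)\<close>, naturally with respect to \<open>\<delta>\<close> and \<open>q(\<delta>)\<close>, the
  module \<open>L\<close> lies in \<open>\<D>\<close> of \<open>q(\<delta>)\<close> iff its inflation lies in \<open>\<D>\<close> of \<open>\<delta>\<close>. Likewise homomorphisms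
  from \<open>(X, \<alpha>)\<close> to an inflation are homomorphisms from \<open>Coker \<alpha>\<close>, so \<open>Coker \<alpha>\<close> generates \<open>L\<close> iff
  \<open>(X, \<alpha>)\<close> generates the inflation. Inflation is exact and commutes with direct sums, so it also
  reflects torsion classes. Finally, \<open>Coker \<alpha>\<close> inherits membership in \<open>\<D>\<close> from \<open>(X, \<alpha>)\<close> because maps
  out of the projective \<open>l P\<^sub>1\<close> lift along \<open>(X, \<alpha>) \<rightarrow> Coker \<alpha>\<close>.
\<close>

section \<open>Homomorphisms, direct sums and quotients\<close>

text \<open>The obstacle is that \<open>q (l P)\<close> is a tensor product over \<open>T\<close>
  built on a tensor product over \<open>R\<close>, each a quotient of a free abelian group, so
  working inside it is awkward. Two maps replace it: \<open>unit\<close>, sending \<open>p\<close>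
  to \<open>1 \<otimes> p\<close> in \<open>l(P)\<close>, and \<open>counit\<close>, sending
  \<open>t \<otimes> p\<close> to the augmentation of \<open>t\<close> times \<open>p\<close>.
  Composing with them converts maps \<open>P \<rightarrow> L\<close> and maps from
  \<open>l(P)\<close> to the inflation of \<open>L\<close> into each other, and
  \<open>q(\<delta>)\<close> turns out to be \<open>counit \<circ> \<delta> \<circ> unit\<close>.
  The tensor ring is kept equally abstract. Its ring axioms come with the presentation, and a
  product in \<open>T\<close> is evaluated in its first component only. The image of
  \<open>\<alpha>\<close> is handled as \<open>M' X\<close>, through
  \<open>\<alpha> (m \<otimes> x) = (0, m) x\<close>, and elements \<open>(0, m)\<close> act as zero
  on inflations. As inflation keeps the carrier type, both sides of the theorem refer to the same
  universe \<open>'u\<close>, and no change of universe is involved.\<close>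

lemma lmod_homI:
  assumes "\<And>x. x \<in> carrier A \<Longrightarrow> h x \<in> carrier B"
    and "\<And>x y. x \<in> carrier A \<Longrightarrow> y \<in> carrier A \<Longrightarrow> h (x \<oplus>\<^bsub>A\<^esub> y) = h x \<oplus>\<^bsub>B\<^esub> h y"
    and "\<And>r x. r \<in> carrier R \<Longrightarrow> x \<in> carrier A \<Longrightarrow> h (r \<odot>\<^bsub>A\<^esub> x) = r \<odot>\<^bsub>B\<^esub> h x"
  shows "h \<in> lmod_hom R A B"
  using assms by (auto simp: lmod_hom_def)

lemma
  assumes "h \<in> lmod_hom R A B"
  shows lmod_hom_closed: "x \<in> carrier A \<Longrightarrow> h x \<in> carrier B"
    and lmod_hom_add:
      "x \<in> carrier A \<Longrightarrow> y \<in> carrier A \<Longrightarrow> h (x \<oplus>\<^bsub>A\<^esub> y) = h x \<oplus>\<^bsub>B\<^esub> h y"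
    and lmod_hom_smult:
      "r \<in> carrier R \<Longrightarrow> x \<in> carrier A \<Longrightarrow> h (r \<odot>\<^bsub>A\<^esub> x) = r \<odot>\<^bsub>B\<^esub> h x"
  using assms by (auto simp: lmod_hom_def)

lemma D_classE:
  assumes "L \<in> D_class R X \<sigma> Z" "f \<in> lmod_hom R X L"
  obtains g where "g \<in> lmod_hom R Z L" "\<And>x. x \<in> carrier X \<Longrightarrow> g (\<sigma> x) = f x"
  using assms by (auto simp: D_class_def)

text \<open>For bare additive maps rather than homomorphisms, since it is also applied to
  \<open>a \<mapsto> a x\<close> with \<open>x\<close> fixed, to multiplication by a fixed scalar,
  and to maps whose linearity is still being proved.\<close>

lemma additive_zero:
  assumes "abelian_group A" "abelian_group B" "\<And>x. x \<in> carrier A \<Longrightarrow> h x \<in> carrier B"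
    and "\<And>x y. x \<in> carrier A \<Longrightarrow> y \<in> carrier A \<Longrightarrow> h (x \<oplus>\<^bsub>A\<^esub> y) = h x \<oplus>\<^bsub>B\<^esub> h y"
  shows "h \<zero>\<^bsub>A\<^esub> = \<zero>\<^bsub>B\<^esub>"
proof -
  interpret A: abelian_group A by fact
  interpret B: abelian_group B by fact
  have "h \<zero>\<^bsub>A\<^esub> \<oplus>\<^bsub>B\<^esub> h \<zero>\<^bsub>A\<^esub> = h \<zero>\<^bsub>A\<^esub>"
    using assms(4)[of "\<zero>\<^bsub>A\<^esub>" "\<zero>\<^bsub>A\<^esub>"] by simp
  then show ?thesis
    using assms(3)[OF A.zero_closed] by (metis B.add.l_cancel_one)
qed

lemma additive_minus:
  assumes "abelian_group A" "abelian_group B" "\<And>x. x \<in> carrier A \<Longrightarrow> h x \<in> carrier B"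
    and "\<And>x y. x \<in> carrier A \<Longrightarrow> y \<in> carrier A \<Longrightarrow> h (x \<oplus>\<^bsub>A\<^esub> y) = h x \<oplus>\<^bsub>B\<^esub> h y"
    and x: "x \<in> carrier A"
  shows "h (\<ominus>\<^bsub>A\<^esub> x) = \<ominus>\<^bsub>B\<^esub> h x"
proof -
  interpret A: abelian_group A by fact
  interpret B: abelian_group B by fact
  have "h (\<ominus>\<^bsub>A\<^esub> x) \<oplus>\<^bsub>B\<^esub> h x = \<zero>\<^bsub>B\<^esub>"
    using assms(4)[of "\<ominus>\<^bsub>A\<^esub> x" x] x additive_zero[of A B h] assms(1-4)
    by (simp add: A.l_neg)
  then show ?thesis
    using assms(3) x by (metis A.a_inv_closed B.minus_equality)
qed

lemma
  assumes "h \<in> lmod_hom R A B" "abelian_group A" "abelian_group B"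
  shows lmod_hom_zero: "h \<zero>\<^bsub>A\<^esub> = \<zero>\<^bsub>B\<^esub>"
    and lmod_hom_minus: "x \<in> carrier A \<Longrightarrow> h (\<ominus>\<^bsub>A\<^esub> x) = \<ominus>\<^bsub>B\<^esub> h x"
  using assms by (auto intro!: additive_zero[of A B h] additive_minus[of A B h]
      simp: lmod_hom_closed lmod_hom_add)

context left_module
begin

lemma lsmult_r_null: "a \<in> carrier R \<Longrightarrow> a \<odot>\<^bsub>M\<^esub> \<zero>\<^bsub>M\<^esub> = \<zero>\<^bsub>M\<^esub>"
  by (rule additive_zero[of M M "smult M a"])
    (auto simp: lsmult_closed lsmult_r_distr M.abelian_group_axioms)

lemma lsmult_l_null: "x \<in> carrier M \<Longrightarrow> \<zero>\<^bsub>R\<^esub> \<odot>\<^bsub>M\<^esub> x = \<zero>\<^bsub>M\<^esub>"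
  by (rule additive_zero[of R M "\<lambda>a. a \<odot>\<^bsub>M\<^esub> x"])
    (auto simp: lsmult_closed lsmult_l_distr M.abelian_group_axioms R.abelian_group_axioms)

lemma lsmult_l_minus:
  "a \<in> carrier R \<Longrightarrow> x \<in> carrier M \<Longrightarrow> (\<ominus>\<^bsub>R\<^esub> a) \<odot>\<^bsub>M\<^esub> x = \<ominus>\<^bsub>M\<^esub> (a \<odot>\<^bsub>M\<^esub> x)"
  by (rule additive_minus[of R M "\<lambda>a. a \<odot>\<^bsub>M\<^esub> x"])
    (auto simp: lsmult_closed lsmult_l_distr M.abelian_group_axioms R.abelian_group_axioms)

end

section \<open>Direct sums: injections, induction on the support, universal property\<close>

definition single :: "'i set \<Rightarrow> ('i \<Rightarrow> ('r, 'm, 'z) module_scheme) \<Rightarrow> 'i \<Rightarrow> 'm \<Rightarrow> 'i \<Rightarrow> 'm"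
  where "single I F i x = (\<lambda>j\<in>I. if j = i then x else \<zero>\<^bsub>F j\<^esub>)"

locale module_family = ring R for R :: "('r, 'k) ring_scheme" (structure) +
  fixes I :: "'i set" and F :: "'i \<Rightarrow> ('r, 'm, 'z) module_scheme"
  assumes modules: "i \<in> I \<Longrightarrow> left_module R (F i)"
begin

abbreviation D where "D \<equiv> dsum I F"

lemma component_group: "i \<in> I \<Longrightarrow> abelian_group (F i)"
  using modules left_module.axioms(2) by blast

lemma dsum_zero_closed: "\<zero>\<^bsub>D\<^esub> \<in> carrier D"
  by (auto simp: dsum_def intro!: abelian_monoid.zero_closed abelian_group.axioms(1) component_group)

lemma dsum_component: "f \<in> carrier D \<Longrightarrow> i \<in> I \<Longrightarrow> f i \<in> carrier (F i)"
  by (auto simp: dsum_def)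

lemma dsum_add_closed:
  assumes "f \<in> carrier D" "g \<in> carrier D"
  shows "f \<oplus>\<^bsub>D\<^esub> g \<in> carrier D"
proof -
  have "{i \<in> I. f i \<oplus>\<^bsub>F i\<^esub> g i \<noteq> \<zero>\<^bsub>F i\<^esub>}
      \<subseteq> {i \<in> I. f i \<noteq> \<zero>\<^bsub>F i\<^esub>} \<union> {i \<in> I. g i \<noteq> \<zero>\<^bsub>F i\<^esub>}"
    using component_group abelian_group.axioms(1) abelian_monoid.l_zero abelian_monoid.zero_closed
    by fastforce
  then have "finite {i \<in> I. f i \<oplus>\<^bsub>F i\<^esub> g i \<noteq> \<zero>\<^bsub>F i\<^esub>}"
    using assms by (rule_tac finite_subset) (auto simp: dsum_def)
  then show ?thesis
    using assms component_group
    by (auto simp: dsum_def PiE_iff cong: conj_cong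
        intro!: abelian_monoid.a_closed abelian_group.axioms(1))
qed

lemma dsum_smult_closed:
  assumes "r \<in> carrier R" "f \<in> carrier D"
  shows "r \<odot>\<^bsub>D\<^esub> f \<in> carrier D"
proof -
  have "{i \<in> I. r \<odot>\<^bsub>F i\<^esub> f i \<noteq> \<zero>\<^bsub>F i\<^esub>} \<subseteq> {i \<in> I. f i \<noteq> \<zero>\<^bsub>F i\<^esub>}"
    using left_module.lsmult_r_null[OF modules] assms by auto
  then have "finite {i \<in> I. r \<odot>\<^bsub>F i\<^esub> f i \<noteq> \<zero>\<^bsub>F i\<^esub>}"
    using assms by (rule_tac finite_subset) (auto simp: dsum_def)
  then show ?thesis
    using assms modules
    by (auto simp: dsum_def PiE_iff left_module.lsmult_closed[OF modules] cong: conj_cong)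
qed

text \<open>For \<open>i\<close> outside \<open>I\<close> this is the zero element; including that
  case lets \<open>projective_lift\<close> choose preimages for all \<open>i\<close> at
  once.\<close>

lemma single_closed: "x \<in> carrier (F i) \<Longrightarrow> single I F i x \<in> carrier D"
  by (auto simp: dsum_def single_def cong: conj_cong
      intro!: abelian_monoid.zero_closed abelian_group.axioms(1) component_group)

lemma single_hom: "i \<in> I \<Longrightarrow> single I F i \<in> lmod_hom R (F i) D"
  by (rule lmod_homI)
    (auto simp: single_closed, auto simp: single_def dsum_def fun_eq_iff
      left_module.lsmult_r_null[OF modules] abelian_group.axioms(1)[OF component_group]
      intro!: abelian_monoid.l_zero[symmetric] abelian_monoid.zero_closed)

lemma dsum_induct [consumes 1, case_names zero add single]:
  assumes f: "f \<in> carrier D"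
    and zero: "P \<zero>\<^bsub>D\<^esub>"
    and add: "\<And>f g. f \<in> carrier D \<Longrightarrow> g \<in> carrier D \<Longrightarrow> P f \<Longrightarrow> P g \<Longrightarrow> P (f \<oplus>\<^bsub>D\<^esub> g)"
    and single: "\<And>i x. i \<in> I \<Longrightarrow> x \<in> carrier (F i) \<Longrightarrow> P (single I F i x)"
  shows "P f"
proof -
  \<comment> \<open>Induction over a finite superset of the support: erasing the coordinate
    \<open>a\<close> leaves an element supported in \<open>A\<close>, even if \<open>f a\<close> was
    already zero.\<close>
  have "P f" if "finite A" "f \<in> carrier D" "{i \<in> I. f i \<noteq> \<zero>\<^bsub>F i\<^esub>} \<subseteq> A" for A f
    using that
  proof (induction A arbitrary: f rule: finite_induct)
    case empty
    then have "f = \<zero>\<^bsub>D\<^esub>"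
      by (auto simp: dsum_def fun_eq_iff PiE_def extensional_def)
    then show ?case using zero by simp
  next
    case (insert a A)
    show ?case
    proof (cases "a \<in> I")
      case False
      then show ?thesis using insert by blast
    next
      case True
      interpret Fa: abelian_group "F a" using component_group[OF True] .
      let ?g = "f(a := \<zero>\<^bsub>F a\<^esub>)"
      have sub: "{i \<in> I. ?g i \<noteq> \<zero>\<^bsub>F i\<^esub>} \<subseteq> {i \<in> I. f i \<noteq> \<zero>\<^bsub>F i\<^esub>}" by auto
      then have fin: "finite {i \<in> I. ?g i \<noteq> \<zero>\<^bsub>F i\<^esub>}"
        by (rule finite_subset) (use insert.prems in \<open>auto simp: dsum_def\<close>)
      have ext: "?g \<in> (\<Pi>\<^sub>E i\<in>I. carrier (F i))"
        using insert.prems True by (auto simp: dsum_def PiE_iff extensional_def)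
      have g: "?g \<in> carrier D"
        using ext fin by (simp add: dsum_def)
      have fa: "f a \<in> carrier (F a)" using insert.prems True dsum_component by blast
      have "f = ?g \<oplus>\<^bsub>D\<^esub> single I F a (f a)"
      proof
        fix i
        show "f i = (?g \<oplus>\<^bsub>D\<^esub> single I F a (f a)) i"
        proof (cases "i \<in> I")
          case False
          then show ?thesis using insert.prems(1) by (simp add: dsum_def PiE_def extensional_def)
        next
          case True
          interpret Fi: abelian_group "F i" using component_group[OF True] .
          have "f i \<in> carrier (F i)" using True insert.prems(1) dsum_component by blast
          then show ?thesis using True by (cases "i = a") (simp_all add: dsum_def single_def)
        qed
      qed
      moreover have "{i \<in> I. ?g i \<noteq> \<zero>\<^bsub>F i\<^esub>} \<subseteq> A"
        using insert.prems(2) by (auto split: if_splits)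
      with g have "P ?g" by (rule insert.IH)
      ultimately show ?thesis
        using add[OF g single_closed[OF fa]] single[OF True fa] by metis
    qed
  qed
  then show ?thesis
    using f by (auto simp: dsum_def)
qed

text \<open>\<open>D\<close> is not shown to be a group, so \<open>additive_zero\<close> does not
  apply; idempotence of the zero of \<open>D\<close> and cancellation in \<open>L\<close>
  suffice.\<close>

lemma dsum_hom_zero:
  assumes p: "p \<in> lmod_hom R D L" and "abelian_group L"
  shows "p \<zero>\<^bsub>D\<^esub> = \<zero>\<^bsub>L\<^esub>"
proof -
  interpret L: abelian_group L by fact
  have "\<zero>\<^bsub>D\<^esub> \<oplus>\<^bsub>D\<^esub> \<zero>\<^bsub>D\<^esub> = \<zero>\<^bsub>D\<^esub>"
    by (auto simp: dsum_def fun_eq_iff intro!: abelian_monoid.l_zero abelian_monoid.zero_closed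
        abelian_group.axioms(1) component_group)
  then show ?thesis
    using lmod_hom_add[OF p dsum_zero_closed dsum_zero_closed] lmod_hom_closed[OF p dsum_zero_closed]
    by (metis L.add.l_cancel_one)
qed

lemma dsum_universal:
  assumes L: "left_module R L" and h: "\<And>i. i \<in> I \<Longrightarrow> h i \<in> lmod_hom R (F i) L"
  obtains H where "H \<in> lmod_hom R D L"
    and "\<And>i x. i \<in> I \<Longrightarrow> x \<in> carrier (F i) \<Longrightarrow> H (single I F i x) = h i x"
proof -
  interpret L: left_module R L by fact
  have Lm: "comm_monoid (add_monoid L)" by (rule L.M.a_comm_monoid)
  \<comment> \<open>\<open>gfinprod\<close> on the additive monoid sums over the indices with
    nonzero term, so \<open>I\<close> itself may be infinite.\<close>
  let ?H = "\<lambda>f. gfinprod (add_monoid L) (\<lambda>i. h i (f i)) I"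
  have cl: "(\<lambda>i. h i (f i)) \<in> I \<rightarrow> carrier L" if "f \<in> carrier D" for f
    using that dsum_component h lmod_hom_closed by fastforce
  have h0: "h i \<zero>\<^bsub>F i\<^esub> = \<zero>\<^bsub>L\<^esub>" if "i \<in> I" for i
    using lmod_hom_zero[OF h[OF that] component_group[OF that] L.M.abelian_group_axioms] .
  have fin: "finite {i \<in> I. h i (f i) \<noteq> \<zero>\<^bsub>L\<^esub>}" if "f \<in> carrier D" for f
  proof (rule finite_subset)
    show "{i \<in> I. h i (f i) \<noteq> \<zero>\<^bsub>L\<^esub>} \<subseteq> {i \<in> I. f i \<noteq> \<zero>\<^bsub>F i\<^esub>}" using h0 by auto
  qed (use that in \<open>simp add: dsum_def\<close>)
  have Hcl: "?H f \<in> carrier L" if "f \<in> carrier D" for f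
    using comm_monoid.gfinprod_closed[OF Lm] cl[OF that] by simp
  have Hadd: "?H (f \<oplus>\<^bsub>D\<^esub> g) = ?H f \<oplus>\<^bsub>L\<^esub> ?H g" if f: "f \<in> carrier D" and g: "g \<in> carrier D" for f g
  proof -
    have "?H (f \<oplus>\<^bsub>D\<^esub> g) = gfinprod (add_monoid L) (\<lambda>i. h i (f i) \<oplus>\<^bsub>L\<^esub> h i (g i)) I"
    proof (rule comm_monoid.gfinprod_cong[OF Lm refl])
      show "(\<lambda>i. h i ((f \<oplus>\<^bsub>D\<^esub> g) i)) \<in> I \<rightarrow> carrier (add_monoid L)"
        using cl[OF dsum_add_closed[OF f g]] by simp
      show "i \<in> I =simp=> h i ((f \<oplus>\<^bsub>D\<^esub> g) i) = h i (f i) \<oplus>\<^bsub>L\<^esub> h i (g i)" for i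
        using dsum_component f g lmod_hom_add[OF h] by (simp add: simp_implies_def dsum_def PiE_mem)
    qed
    also have "\<dots> = ?H f \<oplus>\<^bsub>L\<^esub> ?H g"
      using comm_monoid.gfinprod_distrib[OF Lm, of I "\<lambda>i. h i (f i)" "\<lambda>i. h i (g i)"]
        fin f g cl by simp
    finally show ?thesis .
  qed
  have Hs: "?H (single I F i x) = h i x" if "i \<in> I" "x \<in> carrier (F i)" for i x
  proof -
    have "gfinprod (add_monoid L) (\<lambda>j. h j (single I F i x j)) I
        = gfinprod (add_monoid L) (\<lambda>j. h j (single I F i x j)) {i}"
      using that cl[OF single_closed[OF that(2)]] h0
      by (intro comm_monoid.gfinprod_mono_neutral_cong_right[OF Lm]) (auto simp: single_def)
    also have "\<dots> = h i x"
      using that lmod_hom_closed[OF h] comm_monoid.finprod_singleton[OF Lm]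
      by (subst comm_monoid.gfinprod_eq_finprod[OF Lm])
        (auto simp: single_def comm_monoid.finprod_insert[OF Lm] comm_monoid.finprod_empty[OF Lm])
    finally show ?thesis .
  qed
  \<comment> \<open>Scalars are not pulled through the sum directly: additivity is known already, so
    linearity reduces to the elements \<open>single I F i x\<close>.\<close>
  have Hsm: "?H (r \<odot>\<^bsub>D\<^esub> f) = r \<odot>\<^bsub>L\<^esub> ?H f" if r: "r \<in> carrier R" and f: "f \<in> carrier D" for r f
    using f
  proof (induction rule: dsum_induct)
    case zero
    have z: "\<zero>\<^bsub>D\<^esub> \<oplus>\<^bsub>D\<^esub> \<zero>\<^bsub>D\<^esub> = \<zero>\<^bsub>D\<^esub>" "r \<odot>\<^bsub>D\<^esub> \<zero>\<^bsub>D\<^esub> = \<zero>\<^bsub>D\<^esub>"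
      using r by (auto simp: dsum_def fun_eq_iff left_module.lsmult_r_null[OF modules]
          intro!: abelian_monoid.l_zero abelian_monoid.zero_closed
          abelian_group.axioms(1) component_group)
    then have "?H \<zero>\<^bsub>D\<^esub> = \<zero>\<^bsub>L\<^esub>"
      using Hadd[OF dsum_zero_closed dsum_zero_closed]
        L.M.add.l_cancel_one[OF Hcl[OF dsum_zero_closed] Hcl[OF dsum_zero_closed]] by simp
    then show ?case using z r by (simp add: L.lsmult_r_null)
  next
    case (add f g)
    have "r \<odot>\<^bsub>D\<^esub> (f \<oplus>\<^bsub>D\<^esub> g) = r \<odot>\<^bsub>D\<^esub> f \<oplus>\<^bsub>D\<^esub> r \<odot>\<^bsub>D\<^esub> g"
      using add.hyps r dsum_component by (auto simp: dsum_def fun_eq_iff PiE_mem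
          left_module.lsmult_r_distr[OF modules])
    then show ?case
      using add r Hcl by (simp add: Hadd dsum_smult_closed L.lsmult_r_distr)
  next
    case (single i x)
    have "r \<odot>\<^bsub>D\<^esub> single I F i x = single I F i (r \<odot>\<^bsub>F i\<^esub> x)"
      using single r lmod_hom_smult[OF single_hom] by metis
    then show ?case
      using single r left_module.lsmult_closed[OF modules[OF single(1)]]
      by (simp add: Hs lmod_hom_smult[OF h])
  qed
  have "?H \<in> lmod_hom R D L"
    by (intro lmod_homI Hcl Hadd Hsm)
  then show thesis using Hs that by blast
qed

end

text \<open>A module is generated by \<open>X\<close> iff it equals the trace of \<open>X\<close>, which, unlike the index sets
  in the definition of \<^const>\<open>Gen\<close>, can be compared for modules of different types.\<close>

lemma Gen_iff:
  fixes R :: "('r, 'k) ring_scheme" and X :: "('r, 'x) module" and L :: "('r, 'u) module"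
  assumes X: "left_module R X"
  shows "L \<in> Gen R X \<longleftrightarrow> left_module R L \<and>
    (\<forall>H. subgroup H (add_monoid L) \<and> (\<forall>h \<in> lmod_hom R X L. h ` carrier X \<subseteq> H) \<longrightarrow> carrier L \<subseteq> H)"
    (is "_ \<longleftrightarrow> left_module R L \<and> ?trace")
proof (cases "left_module R L")
  case False
  then show ?thesis by (simp add: Gen_def)
next
  case L: True
  interpret X: left_module R X by fact
  interpret L: left_module R L by fact
  show ?thesis
  proof
    assume "L \<in> Gen R X"
    then obtain I :: "('x \<Rightarrow> 'u) set" and p
      where p: "p \<in> lmod_hom R (dsum I (\<lambda>_. X)) L"
        "p ` carrier (dsum I (\<lambda>_. X)) = carrier L"
      by (auto simp: Gen_def)
    interpret F: module_family R I "\<lambda>_. X" using X by unfold_locales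
    have ?trace
    proof (intro allI impI, elim conjE)
      fix H assume H: "subgroup H (add_monoid L)" and hH: "\<forall>h \<in> lmod_hom R X L. h ` carrier X \<subseteq> H"
      \<comment> \<open>The preimage of \<open>H\<close> under \<open>p\<close> is closed under
        addition and contains each summand, because \<open>p\<close> restricted to one copy of
        \<open>X\<close> is a homomorphism to \<open>L\<close>.\<close>
      have "p f \<in> H" if "f \<in> carrier F.D" for f
        using that
      proof (induction rule: F.dsum_induct)
        case zero
        then show ?case
          using F.dsum_hom_zero[OF p(1) L.M.abelian_group_axioms] subgroup.one_closed[OF H] by simp
      next
        case (add f g)
        then show ?case
          using lmod_hom_add[OF p(1)] subgroup.m_closed[OF H] by simp
      next
        case (single i x)
        have "(\<lambda>x. p (single I (\<lambda>_. X) i x)) \<in> lmod_hom R X L"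
          using lmod_hom_closed[OF p(1)] lmod_hom_add[OF p(1)] lmod_hom_smult[OF p(1)]
            F.single_closed lmod_hom_add[OF F.single_hom[OF single(1)]]
            lmod_hom_smult[OF F.single_hom[OF single(1)]]
          by (intro lmod_homI) auto
        then have "(\<lambda>x. p (single I (\<lambda>_. X) i x)) ` carrier X \<subseteq> H"
          using hH by (rule bspec[rotated])
        then show ?case using single(2) by (simp add: image_subset_iff)
      qed
      then show "carrier L \<subseteq> H" using p(2) by (simp add: image_subset_iff flip: p(2))
    qed
    then show "left_module R L \<and> ?trace" using L by simp
  next
    assume "left_module R L \<and> ?trace"
    \<comment> \<open>Indexing by all homomorphisms, each acting on its own copy of
      \<open>X\<close>, makes the image of \<open>p\<close> contain the image of every homomorphism;
      the trace hypothesis is then applied to that image.\<close>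
    let ?I = "lmod_hom R X L"
    interpret F: module_family R ?I "\<lambda>_. X" using X by unfold_locales
    obtain p where p: "p \<in> lmod_hom R F.D L"
      and ps: "\<And>h x. h \<in> ?I \<Longrightarrow> x \<in> carrier X \<Longrightarrow> p (single ?I (\<lambda>_. X) h x) = h x"
      using F.dsum_universal[of L "\<lambda>h. h"] L by blast
    have "subgroup (p ` carrier F.D) (add_monoid L)"
    proof (rule group.subgroupI[OF L.M.a_group])
      show "p ` carrier F.D \<subseteq> carrier (add_monoid L)" using lmod_hom_closed[OF p] by auto
      show "p ` carrier F.D \<noteq> {}" using F.dsum_zero_closed by blast
    next
      fix a assume "a \<in> p ` carrier F.D"
      then obtain f where f: "f \<in> carrier F.D" "a = p f" by blast
      \<comment> \<open>Negatives come from the scalar -1, as \<open>F.D\<close> is only known to be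
        closed under addition and scalars.\<close>
      have "p ((\<ominus>\<^bsub>R\<^esub> \<one>\<^bsub>R\<^esub>) \<odot>\<^bsub>F.D\<^esub> f) = \<ominus>\<^bsub>L\<^esub> a"
        using f lmod_hom_smult[OF p] lmod_hom_closed[OF p]
        by (simp add: L.lsmult_l_minus L.lsmult_one)
      then have "\<ominus>\<^bsub>L\<^esub> a \<in> p ` carrier F.D"
        using F.dsum_smult_closed[OF _ f(1), of "\<ominus>\<^bsub>R\<^esub> \<one>\<^bsub>R\<^esub>"]
        by (metis X.R.a_inv_closed X.R.one_closed imageI)
      then show "inv\<^bsub>add_monoid L\<^esub> a \<in> p ` carrier F.D" by (simp add: a_inv_def)
    next
      fix a b assume "a \<in> p ` carrier F.D" "b \<in> p ` carrier F.D"
      then obtain f g where "f \<in> carrier F.D" "a = p f" "g \<in> carrier F.D" "b = p g" by blast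
      then show "a \<otimes>\<^bsub>add_monoid L\<^esub> b \<in> p ` carrier F.D"
        using lmod_hom_add[OF p, of f g] F.dsum_add_closed[of f g]
        by (auto intro!: image_eqI[of _ p "f \<oplus>\<^bsub>F.D\<^esub> g"])
    qed
    moreover have "\<forall>h \<in> ?I. h ` carrier X \<subseteq> p ` carrier F.D"
    proof (intro ballI subsetI, elim imageE)
      fix h y x assume "h \<in> ?I" "y = h x" "x \<in> carrier X"
      then show "y \<in> p ` carrier F.D"
        using ps[of h x] F.single_closed[of x h] by (metis imageI)
    qed
    ultimately have "carrier L \<subseteq> p ` carrier F.D"
      using \<open>left_module R L \<and> ?trace\<close> by blast
    then show "L \<in> Gen R X"
      using L p lmod_hom_closed[OF p] unfolding Gen_def by blast
  qed
qed

text \<open>Lift the images of the basis vectors along \<open>e\<close>, extend the lifts to a map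
  \<open>H\<close> on the free module, and precompose with the section \<open>s\<close> of the
  retraction \<open>p\<close>.\<close>

lemma projective_lift:
  fixes R :: "('r, 'k) ring_scheme" and P :: "('r, 'p) module"
  assumes P: "projective_module R P" and A: "left_module R A" and B: "left_module R B"
    and e: "e \<in> lmod_hom R A B" "e ` carrier A = carrier B" and f: "f \<in> lmod_hom R P B"
  obtains g where "g \<in> lmod_hom R P A" "\<And>x. x \<in> carrier P \<Longrightarrow> e (g x) = f x"
proof -
  interpret A: left_module R A by fact
  interpret B: left_module R B by fact
  let ?R = "regular_module R"
  have R: "left_module R ?R"
  proof -
    have "abelian_group ?R"
      by (rule abelian_groupI) (auto simp: regular_module_def A.R.add.m_ac
          intro!: bexI[of _ "\<ominus>\<^bsub>R\<^esub> _"] A.R.l_neg)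
    then show ?thesis
      by (intro left_module.intro left_module_axioms.intro A.R.ring_axioms)
        (auto simp: regular_module_def A.R.l_distr A.R.r_distr A.R.m_assoc)
  qed
  obtain I :: "'p set" and s p
    where s: "s \<in> lmod_hom R P (dsum I (\<lambda>_. ?R))" and p: "p \<in> lmod_hom R (dsum I (\<lambda>_. ?R)) P"
      and ps: "\<And>x. x \<in> carrier P \<Longrightarrow> p (s x) = x"
    using P by (auto simp: projective_module_def)
  interpret F: module_family R I "\<lambda>_. ?R"
    using R by (simp add: module_family_def module_family_axioms_def A.R.ring_axioms)
  let ?u = "\<lambda>i. f (p (single I (\<lambda>_. ?R) i \<one>\<^bsub>R\<^esub>))"
  have one: "\<one>\<^bsub>R\<^esub> \<in> carrier ?R" by (simp add: regular_module_def)
  have "\<exists>a\<in>carrier A. e a = ?u i" for i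
    using e(2) F.single_closed[OF one] lmod_hom_closed[OF f] lmod_hom_closed[OF p]
    by (metis (no_types, lifting) imageE)
  then obtain a where a: "\<And>i. a i \<in> carrier A" "\<And>i. e (a i) = ?u i" by metis
  have a_hom: "(\<lambda>r. r \<odot>\<^bsub>A\<^esub> a i) \<in> lmod_hom R ?R A" for i
    by (rule lmod_homI)
      (auto simp: regular_module_def a A.lsmult_closed A.lsmult_l_distr A.lsmult_assoc)
  obtain H where H: "H \<in> lmod_hom R F.D A"
    and Hs: "\<And>i r. i \<in> I \<Longrightarrow> r \<in> carrier ?R \<Longrightarrow> H (single I (\<lambda>_. ?R) i r) = r \<odot>\<^bsub>A\<^esub> a i"
    using F.dsum_universal[of A "\<lambda>i r. r \<odot>\<^bsub>A\<^esub> a i", OF A a_hom] by blast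
  \<comment> \<open>\<open>e \<circ> H = f \<circ> p\<close> on the whole free module, as it holds
    on multiples of basis vectors. At \<open>s x\<close> the right side is
    \<open>f x\<close>.\<close>
  have eH: "e (H \<phi>) = f (p \<phi>)" if "\<phi> \<in> carrier F.D" for \<phi>
    using that
  proof (induction rule: F.dsum_induct)
    case zero
    have "left_module R P" using P by (simp add: projective_module_def)
    then have "abelian_group P" by (rule left_module.axioms(2))
    then show ?case
      using F.dsum_hom_zero[OF H] F.dsum_hom_zero[OF p] lmod_hom_zero[OF e(1)] lmod_hom_zero[OF f]
      by (simp add: A.M.abelian_group_axioms B.M.abelian_group_axioms)
  next
    case (add \<phi> \<psi>)
    then show ?case
      using lmod_hom_closed[OF H] lmod_hom_closed[OF p] by (simp add: lmod_hom_add[OF H]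
        lmod_hom_add[OF p] lmod_hom_add[OF e(1)] lmod_hom_add[OF f])
  next
    case (single i r)
    have r: "r \<in> carrier R" using single by (simp add: regular_module_def)
    have "single I (\<lambda>_. ?R) i r = r \<odot>\<^bsub>F.D\<^esub> single I (\<lambda>_. ?R) i \<one>\<^bsub>R\<^esub>"
      using lmod_hom_smult[OF F.single_hom[OF single(1)] r one] r by (simp add: regular_module_def)
    then have "f (p (single I (\<lambda>_. ?R) i r)) = r \<odot>\<^bsub>B\<^esub> e (a i)"
      using r a F.single_closed[OF one] lmod_hom_closed[OF p]
      by (simp add: lmod_hom_smult[OF p] lmod_hom_smult[OF f])
    moreover have "e (H (single I (\<lambda>_. ?R) i r)) = r \<odot>\<^bsub>B\<^esub> e (a i)"
      using single r a by (simp add: Hs lmod_hom_smult[OF e(1)])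
    ultimately show ?case by simp
  qed
  show thesis
  proof
    show "(\<lambda>x. H (s x)) \<in> lmod_hom R P A"
      using lmod_hom_closed[OF s] lmod_hom_closed[OF H]
      by (intro lmod_homI) (simp_all add: lmod_hom_add[OF s] lmod_hom_add[OF H]
          lmod_hom_smult[OF s] lmod_hom_smult[OF H])
    show "e (H (s x)) = f x" if "x \<in> carrier P" for x
      using that by (simp add: eH lmod_hom_closed[OF s] ps)
  qed
qed

section \<open>Quotient modules and their universal property\<close>

locale left_submodule = left_module R M for R :: "('r, 'k) ring_scheme" (structure)
    and M :: "('r, 'm, 'z) module_scheme" (structure) +
  fixes B
  assumes subgroup: "subgroup B (add_monoid M)"
    and lsmult_mem: "r \<in> carrier R \<Longrightarrow> b \<in> B \<Longrightarrow> r \<odot>\<^bsub>M\<^esub> b \<in> B"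
begin

sublocale abelian_subgroup B M
  using subgroup M.a_comm_group by (intro abelian_subgroupI2)

abbreviation Q where "Q \<equiv> quot_module M B"

abbreviation cls where "cls x \<equiv> B +>\<^bsub>M\<^esub> x"

lemma Q_carrier: "carrier Q = cls ` carrier M"
  by (auto simp: quot_module_def A_RCOSETS_def')

lemma Q_zero: "\<zero>\<^bsub>Q\<^esub> = B"
  by (simp add: quot_module_def)

lemma Q_zero_cls: "\<zero>\<^bsub>Q\<^esub> = cls \<zero>\<^bsub>M\<^esub>"
  by (simp add: Q_zero a_subset)

lemma cls_eq_iff: "x \<in> carrier M \<Longrightarrow> y \<in> carrier M \<Longrightarrow> cls x = cls y \<longleftrightarrow> x \<ominus>\<^bsub>M\<^esub> y \<in> B"
  by (metis M.minus_eq a_rcos_module a_repr_independence' a_rcos_self)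

lemma cls_eq_zero_iff: "x \<in> carrier M \<Longrightarrow> cls x = \<zero>\<^bsub>Q\<^esub> \<longleftrightarrow> x \<in> B"
  by (metis Q_zero M.a_coset_join1 M.a_coset_join2 subgroup)

lemma cls_add:
  "x \<in> carrier M \<Longrightarrow> y \<in> carrier M \<Longrightarrow> cls (x \<oplus>\<^bsub>M\<^esub> y) = cls x \<oplus>\<^bsub>Q\<^esub> cls y"
  by (simp add: quot_module_def a_rcos_sum)

lemma cls_smult:
  assumes r: "r \<in> carrier R" and x: "x \<in> carrier M"
  shows "cls (r \<odot>\<^bsub>M\<^esub> x) = r \<odot>\<^bsub>Q\<^esub> cls x"
proof -
  \<comment> \<open>The scalar action on cosets is a union over representatives; it is a single
    coset because \<open>r (y - x)\<close> stays in \<open>B\<close>.\<close>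
  have "cls (r \<odot>\<^bsub>M\<^esub> y) = cls (r \<odot>\<^bsub>M\<^esub> x)" if y: "y \<in> cls x" for y
  proof -
    have yM: "y \<in> carrier M" using y x a_r_coset_subset_G a_subset by blast
    have "y \<ominus>\<^bsub>M\<^esub> x \<in> B" using a_repr_independence'[OF y x] cls_eq_iff[OF yM x] by simp
    then have "r \<odot>\<^bsub>M\<^esub> (y \<ominus>\<^bsub>M\<^esub> x) \<in> B" using r lsmult_mem by blast
    moreover have "r \<odot>\<^bsub>M\<^esub> (y \<ominus>\<^bsub>M\<^esub> x) = r \<odot>\<^bsub>M\<^esub> y \<ominus>\<^bsub>M\<^esub> r \<odot>\<^bsub>M\<^esub> x"
      using r x yM additive_minus[of M M "smult M r" x]
      by (simp add: M.minus_eq lsmult_r_distr lsmult_closed M.abelian_group_axioms)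
    ultimately show ?thesis using r x yM by (simp add: cls_eq_iff lsmult_closed)
  qed
  then have "(\<Union>y\<in>cls x. cls (r \<odot>\<^bsub>M\<^esub> y)) = (\<Union>y\<in>cls x. cls (r \<odot>\<^bsub>M\<^esub> x))"
    by (rule SUP_cong[OF refl])
  moreover have "cls x \<noteq> {}" using x a_rcos_self by blast
  ultimately show ?thesis by (simp add: quot_module_def)
qed

lemma cls_hom: "cls \<in> lmod_hom R M Q"
  by (rule lmod_homI) (auto simp: Q_carrier cls_add cls_smult)

lemma quot_left_module: "left_module R Q"
proof -
  have "abelian_group Q"
  proof (rule abelian_groupI)
    show "\<exists>y\<in>carrier Q. y \<oplus>\<^bsub>Q\<^esub> x = \<zero>\<^bsub>Q\<^esub>" if x: "x \<in> carrier Q" for x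
    proof -
      obtain z where "z \<in> carrier M" "x = cls z" using x by (auto simp: Q_carrier)
      then have "cls (\<ominus>\<^bsub>M\<^esub> z) \<in> carrier Q" "cls (\<ominus>\<^bsub>M\<^esub> z) \<oplus>\<^bsub>Q\<^esub> x = \<zero>\<^bsub>Q\<^esub>"
        by (simp_all add: Q_carrier Q_zero_cls M.l_neg flip: cls_add)
      then show ?thesis by blast
    qed
  qed (auto simp: Q_carrier Q_zero_cls M.a_ac simp flip: cls_add)
  then show ?thesis
    by (intro left_module.intro left_module_axioms.intro R.ring_axioms)
      (auto simp: Q_carrier lsmult_closed lsmult_one lsmult_l_distr lsmult_r_distr lsmult_assoc
        simp flip: cls_add cls_smult)
qed

lemma quot_universal:
  assumes h: "h \<in> lmod_hom R M L" and L: "left_module R L" and hB: "\<And>b. b \<in> B \<Longrightarrow> h b = \<zero>\<^bsub>L\<^esub>"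
  obtains g where "g \<in> lmod_hom R Q L" "\<And>x. x \<in> carrier M \<Longrightarrow> g (cls x) = h x"
proof -
  interpret L: left_module R L by fact
  have "h x = h y" if x: "x \<in> carrier M" and y: "y \<in> carrier M" and "cls x = cls y" for x y
  proof -
    have "h (x \<ominus>\<^bsub>M\<^esub> y) = \<zero>\<^bsub>L\<^esub>" using that cls_eq_iff hB by blast
    then have "h x \<ominus>\<^bsub>L\<^esub> h y = \<zero>\<^bsub>L\<^esub>"
      using x y lmod_hom_add[OF h, of x "\<ominus>\<^bsub>M\<^esub> y"]
        lmod_hom_minus[OF h M.abelian_group_axioms L.M.abelian_group_axioms, of y]
      by (simp add: M.minus_eq L.M.minus_eq)
    then show ?thesis
      using x y lmod_hom_closed[OF h] L.M.minus_equality[of "h x" "\<ominus>\<^bsub>L\<^esub> h y"]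
      by (simp add: L.M.minus_eq)
  qed
  \<comment> \<open>\<open>h\<close> is constant on cosets, so it factors through \<open>cls\<close>
    as a mere function; linearity is inherited from \<open>h\<close> and \<open>cls\<close>.\<close>
  then obtain g where g: "\<And>x. x \<in> carrier M \<Longrightarrow> g (cls x) = h x"
    using function_factors_left_gen[of "\<lambda>x. x \<in> carrier M" cls h] by metis
  have "g \<in> lmod_hom R Q L"
    by (rule lmod_homI) (auto simp: Q_carrier g lmod_hom_closed[OF h] lmod_hom_add[OF h]
        lmod_hom_smult[OF h] lsmult_closed simp flip: cls_add cls_smult)
  then show thesis using g that by blast
qed

end

section \<open>Presented abelian groups and tensor products\<close>

locale presentation =
  fixes S :: "'g set" and rels :: "('g \<Rightarrow>\<^sub>0 int) set"
  assumes rels_closed: "f \<in> rels \<Longrightarrow> Poly_Mapping.keys f \<subseteq> S"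
begin

abbreviation FA where "FA \<equiv> free_Abelian_group S"
abbreviation K where "K \<equiv> pres_relgp S rels"
abbreviation cl where "cl \<equiv> pres_class S rels"
abbreviation G where "G \<equiv> pres_group S rels"

lemma K_subgroup: "subgroup K FA"
  unfolding pres_relgp_def
  by (rule group.generate_is_subgroup) (auto dest: rels_closed)

lemma K_normal: "K \<lhd> FA"
  by (rule comm_group.subgroup_imp_normal[OF abelian_free_Abelian_group K_subgroup])

lemma rels_in_K: "f \<in> rels \<Longrightarrow> f \<in> K"
  unfolding pres_relgp_def by (rule generate.incl)

lemma comm_group_pres_group: "comm_group G"
  unfolding pres_group_def
  by (rule comm_group.abelian_FactGroup[OF abelian_free_Abelian_group K_subgroup])

lemma carrier_pres_group: "carrier G = cl ` {f. Poly_Mapping.keys f \<subseteq> S}"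
  by (auto simp: pres_group_def FactGroup_def RCOSETS_def pres_class_def)

lemma cl_closed: "Poly_Mapping.keys f \<subseteq> S \<Longrightarrow> cl f \<in> carrier G"
  by (simp add: carrier_pres_group)

lemma cl_zero: "cl 0 = \<one>\<^bsub>G\<^esub>"
  using group.coset_mult_one[OF group_free_Abelian_group subgroup.subset[OF K_subgroup]]
  by (simp add: pres_group_def FactGroup_def pres_class_def)

lemma cl_add:
  "Poly_Mapping.keys f \<subseteq> S \<Longrightarrow> Poly_Mapping.keys g \<subseteq> S \<Longrightarrow> cl (f + g) = cl f \<otimes>\<^bsub>G\<^esub> cl g"
  using normal.rcos_sum[OF K_normal, of f g]
  by (simp add: pres_group_def FactGroup_def pres_class_def)

lemma cl_eq_iff:
  assumes "Poly_Mapping.keys f \<subseteq> S" "Poly_Mapping.keys g \<subseteq> S"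
  shows "cl f = cl g \<longleftrightarrow> f - g \<in> K"
proof -
  have "f \<in> cl g \<longleftrightarrow> f - g \<in> K"
    using subgroup.rcos_module[OF K_subgroup group_free_Abelian_group, of g f] assms
    by (simp add: pres_class_def)
  moreover have "f \<in> cl f"
    using group.rcos_self[OF group_free_Abelian_group _ K_subgroup, of f] assms
    by (simp add: pres_class_def)
  moreover have "f \<in> cl g \<Longrightarrow> cl g = cl f"
    using group.repr_independence[OF group_free_Abelian_group _ _ K_subgroup, of f g] assms
    by (simp add: pres_class_def)
  ultimately show ?thesis by blast
qed

lemma mem_cl:
  assumes f: "f \<in> cl g" and g: "Poly_Mapping.keys g \<subseteq> S"
  shows "Poly_Mapping.keys f \<subseteq> S" "f - g \<in> K"
proof -
  have "K #>\<^bsub>FA\<^esub> g \<subseteq> carrier FA"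
    using g by (intro monoid.r_coset_subset_G subgroup.subset[OF K_subgroup])
      (simp_all add: group.is_monoid)
  then have "f \<in> carrier FA" using f unfolding pres_class_def by (rule subsetD)
  then show "Poly_Mapping.keys f \<subseteq> S" by simp
  then show "f - g \<in> K"
    using subgroup.rcos_module[OF K_subgroup group_free_Abelian_group, of g f] f g
    by (simp add: pres_class_def)
qed

lemma pres_group_induct [consumes 1, case_names zero add minus generator]:
  assumes c: "c \<in> carrier G"
    and zero: "P \<one>\<^bsub>G\<^esub>"
    and add: "\<And>a b. a \<in> carrier G \<Longrightarrow> b \<in> carrier G \<Longrightarrow> P a \<Longrightarrow> P b \<Longrightarrow> P (a \<otimes>\<^bsub>G\<^esub> b)"
    and minus: "\<And>a. a \<in> carrier G \<Longrightarrow> P a \<Longrightarrow> P (inv\<^bsub>G\<^esub> a)"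
    and generator: "\<And>s. s \<in> S \<Longrightarrow> P (cl (frag_of s))"
  shows "P c"
proof -
  interpret G: comm_group G by (rule comm_group_pres_group)
  obtain f where f: "Poly_Mapping.keys f \<subseteq> S" "c = cl f" using c carrier_pres_group by auto
  have "P (cl f)"
    using f(1)
  proof (induction rule: free_Abelian_group_induct[consumes 1, case_names zero diff generator])
    case zero
    then show ?case using assms(2) by (simp add: cl_zero)
  next
    case (diff x y)
    have "Poly_Mapping.keys (x - y) \<subseteq> S" using diff.hyps keys_diff[of x y] by blast
    then have "cl x = cl (x - y) \<otimes>\<^bsub>G\<^esub> cl y"
      using cl_add[of "x - y" y] diff.hyps by simp
    then have "cl (x - y) = cl x \<otimes>\<^bsub>G\<^esub> inv\<^bsub>G\<^esub> cl y"
      using diff.hyps cl_closed \<open>Poly_Mapping.keys (x - y) \<subseteq> S\<close> by (simp add: G.m_assoc)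
    then show ?case using diff add minus cl_closed by simp
  next
    case (generator a)
    then show ?case by (rule assms(5))
  qed
  then show ?thesis using f by simp
qed

text \<open>The relator condition ranges over every homomorphism that extends \<open>\<phi>\<close>,
  so a user checks it from the values on generators alone, without a formula for the
  extension.\<close>

lemma pres_group_universal:
  assumes H: "comm_group H" and \<phi>: "\<phi> \<in> S \<rightarrow> carrier H"
    and rels: "\<And>h f. h \<in> hom FA H \<Longrightarrow> (\<And>s. s \<in> S \<Longrightarrow> h (frag_of s) = \<phi> s) \<Longrightarrow> f \<in> rels \<Longrightarrow> h f = \<one>\<^bsub>H\<^esub>"
  obtains h where "h \<in> hom G H" "\<And>s. s \<in> S \<Longrightarrow> h (cl (frag_of s)) = \<phi> s"
proof -
  interpret H: comm_group H by fact
  obtain h where h: "h \<in> hom FA H" and hs: "\<And>s. s \<in> S \<Longrightarrow> h (frag_of s) = \<phi> s"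
    using H.free_Abelian_group_universal[of \<phi> S] \<phi> by blast
  interpret h: group_hom FA H h
    using h by (simp add: group_hom_def group_hom_axioms_def)
  have "K \<subseteq> kernel FA H h"
    unfolding pres_relgp_def
  proof (rule group.generate_subgroup_incl[OF group_free_Abelian_group _ h.subgroup_kernel])
    show "rels \<subseteq> kernel FA H h"
      using rels[OF h hs] rels_closed by (auto simp: kernel_def)
  qed
  then obtain g where "g \<in> hom (FA Mod K) H"
    "\<And>x. x \<in> carrier FA \<Longrightarrow> g (K #>\<^bsub>FA\<^esub> x) = h x"
    using h.FactGroup_universal_kernel[OF K_normal] by blast
  then show thesis
    using that[of g] hs by (simp add: pres_group_def pres_class_def)
qed

end

text \<open>It suffices to look at the relators: the elements with image in the target's relation
  subgroup are closed under the group operations.\<close>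

lemma frag_extend_in_relgp:
  assumes "presentation S rels" "presentation S' rels'" and \<phi>: "\<phi> \<in> S \<rightarrow> S'"
    and rels: "\<And>f. f \<in> rels \<Longrightarrow> frag_extend (\<lambda>x. frag_of (\<phi> x)) f \<in> pres_relgp S' rels'"
    and f: "f \<in> pres_relgp S rels"
  shows "frag_extend (\<lambda>x. frag_of (\<phi> x)) f \<in> pres_relgp S' rels'"
proof -
  interpret A: presentation S rels by fact
  interpret B: presentation S' rels' by fact
  note B = subgroup.one_closed[OF B.K_subgroup] subgroup.m_closed[OF B.K_subgroup]
  have B_minus: "- g \<in> B.K" if "g \<in> B.K" for g
  proof -
    have "Poly_Mapping.keys g \<subseteq> S'"
      using subgroup.mem_carrier[OF B.K_subgroup that] by simp
    then show ?thesis using subgroup.m_inv_closed[OF B.K_subgroup that] by simp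
  qed
  show ?thesis
    using f unfolding pres_relgp_def[of S]
  proof (induction rule: generate.induct)
    case one
    then show ?case using B by simp
  next
    case (incl h)
    then show ?case by (rule rels)
  next
    case (inv h)
    then show ?case
      using rels B_minus A.rels_closed by (simp add: frag_extend_minus)
  next
    case (eng h1 h2)
    then show ?case using B(2) by (simp add: frag_extend_add)
  qed
qed

text \<open>\<open>pres_map\<close> is a union over all representatives of a class. Two of them
  differ by a relation, whose image is again a relation, so the union repeats one coset.\<close>

lemma pres_map_class:
  assumes "presentation S rels" "presentation S' rels'" and \<phi>: "\<phi> \<in> S \<rightarrow> S'"
    and rels: "\<And>f. f \<in> rels \<Longrightarrow> frag_extend (\<lambda>x. frag_of (\<phi> x)) f \<in> pres_relgp S' rels'"
    and f: "Poly_Mapping.keys f \<subseteq> S"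
  shows "pres_map S' rels' \<phi> (pres_class S rels f)
    = pres_class S' rels' (frag_extend (\<lambda>x. frag_of (\<phi> x)) f)"
proof -
  interpret A: presentation S rels by fact
  interpret B: presentation S' rels' by fact
  let ?F = "frag_extend (\<lambda>x. frag_of (\<phi> x))"
  have keys: "Poly_Mapping.keys (?F g) \<subseteq> S'" if "Poly_Mapping.keys g \<subseteq> S" for g
    using keys_frag_extend[of "\<lambda>x. frag_of (\<phi> x)" g] that \<phi> by (fastforce simp: keys_frag_of)
  have "B.cl (?F g) = B.cl (?F f)" if "g \<in> A.cl f" for g
  proof -
    have g: "Poly_Mapping.keys g \<subseteq> S" "g - f \<in> A.K" using A.mem_cl[OF that f] .
    then have "?F g - ?F f \<in> B.K"
      using frag_extend_in_relgp[OF assms(1-4), of "g - f"] by (simp add: frag_extend_diff)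
    then show ?thesis using B.cl_eq_iff keys f g by simp
  qed
  then have "(\<Union>g\<in>A.cl f. B.cl (?F g)) = (\<Union>g\<in>A.cl f. B.cl (?F f))"
    by (rule SUP_cong[OF refl])
  moreover have "f \<in> A.cl f"
    using group.rcos_self[OF group_free_Abelian_group _ A.K_subgroup, of f] f
    by (simp add: pres_class_def)
  ultimately show ?thesis by (auto simp: pres_map_def)
qed

text \<open>Closure conditions are what puts the relators into the free group on
  \<open>carrier M \<times> carrier X\<close>. In this form the locale covers
  \<open>M' \<otimes> X\<close>, \<open>T \<otimes> P\<close> and, over \<open>T\<close>,
  \<open>R \<otimes> l(P)\<close>, before any bimodule structure has been established.\<close>

locale tensor_product =
  fixes R :: "('r, 'k) ring_scheme" and M :: "('s, 'r, 'm, 'y) bimodule_scheme"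
    and X :: "('r, 'x, 'z) module_scheme"
  assumes M_add: "m \<in> carrier M \<Longrightarrow> m' \<in> carrier M \<Longrightarrow> m \<oplus>\<^bsub>M\<^esub> m' \<in> carrier M"
    and M_rsmult: "m \<in> carrier M \<Longrightarrow> r \<in> carrier R \<Longrightarrow> rsmult M m r \<in> carrier M"
    and X_add: "x \<in> carrier X \<Longrightarrow> x' \<in> carrier X \<Longrightarrow> x \<oplus>\<^bsub>X\<^esub> x' \<in> carrier X"
    and X_smult: "r \<in> carrier R \<Longrightarrow> x \<in> carrier X \<Longrightarrow> r \<odot>\<^bsub>X\<^esub> x \<in> carrier X"
begin

sublocale presentation "carrier M \<times> carrier X" "tensor_rels R M X"
proof
  have d: "Poly_Mapping.keys (frag_of a - frag_of b) \<subseteq> {a, b}" for a b :: "'m \<times> 'x"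
    using keys_diff[of "frag_of a" "frag_of b"] by (auto simp: keys_frag_of)
  have d3: "Poly_Mapping.keys (frag_of a - frag_of b - frag_of c) \<subseteq> {a, b, c}" for a b c :: "'m \<times> 'x"
    using keys_diff[of "frag_of a - frag_of b" "frag_of c"] d[of a b] by (auto simp: keys_frag_of)
  show "f \<in> tensor_rels R M X \<Longrightarrow> Poly_Mapping.keys f \<subseteq> carrier M \<times> carrier X" for f
    unfolding tensor_rels_def
    by (elim UnE CollectE exE conjE; simp only:; rule order_trans[OF d] order_trans[OF d3];
        simp add: M_add M_rsmult X_add X_smult)
qed

abbreviation Te where "Te \<equiv> tensor R M X"

abbreviation pure where "pure \<equiv> pure_tensor R M X"

lemma tensor_simps:
  "carrier Te = carrier G" "add Te = monoid.mult G" "\<zero>\<^bsub>Te\<^esub> = \<one>\<^bsub>G\<^esub>"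
  by (simp_all add: tensor_def Let_def)

lemma abelian_group_tensor: "abelian_group Te"
proof -
  interpret G: comm_group G by (rule comm_group_pres_group)
  show ?thesis
    by (rule abelian_groupI) (auto simp: tensor_simps G.m_ac intro!: G.l_inv_ex)
qed

lemma pure_closed: "m \<in> carrier M \<Longrightarrow> x \<in> carrier X \<Longrightarrow> pure m x \<in> carrier Te"
  by (simp add: tensor_simps pure_tensor_def cl_closed keys_frag_of)

lemma pure_add_right:
  assumes "m \<in> carrier M" "x \<in> carrier X" "x' \<in> carrier X"
  shows "pure m (x \<oplus>\<^bsub>X\<^esub> x') = pure m x \<oplus>\<^bsub>Te\<^esub> pure m x'"
proof -
  have "frag_of (m, x \<oplus>\<^bsub>X\<^esub> x') - frag_of (m, x) - frag_of (m, x') \<in> K"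
    using assms by (intro rels_in_K) (auto simp: tensor_rels_def)
  then have "cl (frag_of (m, x \<oplus>\<^bsub>X\<^esub> x')) = cl (frag_of (m, x) + frag_of (m, x'))"
    using assms X_add keys_add[of "frag_of (m, x)" "frag_of (m, x')"]
    by (subst cl_eq_iff) (auto simp: keys_frag_of diff_diff_eq)
  then show ?thesis
    using assms by (simp add: tensor_simps pure_tensor_def cl_add keys_frag_of)
qed

lemma pure_balanced:
  assumes "m \<in> carrier M" "r \<in> carrier R" "x \<in> carrier X"
  shows "pure (rsmult M m r) x = pure m (r \<odot>\<^bsub>X\<^esub> x)"
proof -
  have "frag_of (rsmult M m r, x) - frag_of (m, r \<odot>\<^bsub>X\<^esub> x) \<in> K"
    using assms by (intro rels_in_K) (auto simp: tensor_rels_def)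
  then show ?thesis
    using assms M_rsmult X_smult by (simp add: pure_tensor_def cl_eq_iff keys_frag_of)
qed

lemma tensor_induct [consumes 1, case_names zero add minus pure]:
  assumes "c \<in> carrier Te"
    and "P \<zero>\<^bsub>Te\<^esub>"
    and "\<And>a b. a \<in> carrier Te \<Longrightarrow> b \<in> carrier Te \<Longrightarrow> P a \<Longrightarrow> P b \<Longrightarrow> P (a \<oplus>\<^bsub>Te\<^esub> b)"
    and "\<And>a. a \<in> carrier Te \<Longrightarrow> P a \<Longrightarrow> P (\<ominus>\<^bsub>Te\<^esub> a)"
    and "\<And>m x. m \<in> carrier M \<Longrightarrow> x \<in> carrier X \<Longrightarrow> P (pure m x)"
  shows "P c"
proof -
  \<comment> \<open>Both inverses are determined by carrier, unit and operation, which agree for the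
    two records.\<close>
  have inv: "inv\<^bsub>G\<^esub> a = \<ominus>\<^bsub>Te\<^esub> a" for a
    by (simp add: a_inv_def m_inv_def tensor_simps)
  have "c \<in> carrier G" using assms(1) by (simp add: tensor_simps)
  then show ?thesis
    by (induction rule: pres_group_induct)
      (use assms in \<open>auto simp: tensor_simps inv pure_tensor_def\<close>)
qed

text \<open>The map produced is additive only; linearity over scalars acting on the left factor is
  left to an induction on tensors, as in \<open>counit_ex\<close>.\<close>

lemma tensor_universal:
  assumes L: "abelian_group L"
    and cl: "\<And>m x. m \<in> carrier M \<Longrightarrow> x \<in> carrier X \<Longrightarrow> \<beta> m x \<in> carrier L"
    and left: "\<And>m m' x. m \<in> carrier M \<Longrightarrow> m' \<in> carrier M \<Longrightarrow> x \<in> carrier X \<Longrightarrow>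
      \<beta> (m \<oplus>\<^bsub>M\<^esub> m') x = \<beta> m x \<oplus>\<^bsub>L\<^esub> \<beta> m' x"
    and right: "\<And>m x x'. m \<in> carrier M \<Longrightarrow> x \<in> carrier X \<Longrightarrow> x' \<in> carrier X \<Longrightarrow>
      \<beta> m (x \<oplus>\<^bsub>X\<^esub> x') = \<beta> m x \<oplus>\<^bsub>L\<^esub> \<beta> m x'"
    and balanced: "\<And>m r x. m \<in> carrier M \<Longrightarrow> r \<in> carrier R \<Longrightarrow> x \<in> carrier X \<Longrightarrow>
      \<beta> (rsmult M m r) x = \<beta> m (r \<odot>\<^bsub>X\<^esub> x)"
  obtains h where "\<And>c. c \<in> carrier Te \<Longrightarrow> h c \<in> carrier L"
    and "\<And>c d. c \<in> carrier Te \<Longrightarrow> d \<in> carrier Te \<Longrightarrow> h (c \<oplus>\<^bsub>Te\<^esub> d) = h c \<oplus>\<^bsub>L\<^esub> h d"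
    and "\<And>m x. m \<in> carrier M \<Longrightarrow> x \<in> carrier X \<Longrightarrow> h (pure m x) = \<beta> m x"
proof -
  interpret L: abelian_group L by fact
  let ?L = "add_monoid L"
  have cg: "comm_group ?L" by (rule L.a_comm_group)
  have "\<exists>h. h \<in> hom G ?L \<and> (\<forall>s \<in> carrier M \<times> carrier X. h (cl (frag_of s)) = (case s of (m, x) \<Rightarrow> \<beta> m x))"
  proof (rule pres_group_universal[OF cg, of "\<lambda>(m, x). \<beta> m x"])
    show "(\<lambda>(m, x). \<beta> m x) \<in> carrier M \<times> carrier X \<rightarrow> carrier ?L" using cl by auto
  next
    fix h f
    assume h: "h \<in> hom FA ?L"
      and hs: "\<And>s. s \<in> carrier M \<times> carrier X \<Longrightarrow> h (frag_of s) = (case s of (m, x) \<Rightarrow> \<beta> m x)"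
      and f: "f \<in> tensor_rels R M X"
    interpret h: group_hom FA ?L h
      using h cg by (simp add: group_hom_def group_hom_axioms_def comm_group_def)
    have hd: "h (a - b) = h a \<ominus>\<^bsub>L\<^esub> h b"
      if "Poly_Mapping.keys a \<subseteq> carrier M \<times> carrier X" "Poly_Mapping.keys b \<subseteq> carrier M \<times> carrier X" for a b
      using that h.hom_mult[of a "- b"] h.hom_inv[of b] by (simp add: a_minus_def a_inv_def)
    \<comment> \<open>A relator \<open>a - b - c\<close> is read as \<open>a - (b + c)\<close>, so
      biadditivity of \<open>\<beta>\<close> turns its image into a difference of equal
      elements.\<close>
    have hd3: "h (a - b - c) = h a \<ominus>\<^bsub>L\<^esub> (h b \<oplus>\<^bsub>L\<^esub> h c)"
      if "Poly_Mapping.keys a \<subseteq> carrier M \<times> carrier X" "Poly_Mapping.keys b \<subseteq> carrier M \<times> carrier X"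
        "Poly_Mapping.keys c \<subseteq> carrier M \<times> carrier X" for a b c
      using that hd[of a "b + c"] h.hom_mult[of b c] keys_add[of b c] by (auto simp: diff_diff_eq)
    show "h f = \<one>\<^bsub>?L\<^esub>"
      using f unfolding tensor_rels_def
      by (auto simp: hd hd3 hs keys_frag_of M_add X_add M_rsmult X_smult cl left right balanced
          L.minus_eq L.r_neg)
  qed blast
  then obtain h where h: "h \<in> hom G ?L"
    and hs: "\<And>m x. m \<in> carrier M \<Longrightarrow> x \<in> carrier X \<Longrightarrow> h (pure m x) = \<beta> m x"
    by (auto simp: pure_tensor_def)
  show thesis
    by (rule that[of h]) (use h hs in \<open>auto simp: hom_def tensor_simps\<close>)
qed

lemma tensor_additive_eq:
  assumes L: "abelian_group L" and c: "c \<in> carrier Te"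
    and h: "\<And>c. c \<in> carrier Te \<Longrightarrow> h c \<in> carrier L"
      "\<And>c d. c \<in> carrier Te \<Longrightarrow> d \<in> carrier Te \<Longrightarrow> h (c \<oplus>\<^bsub>Te\<^esub> d) = h c \<oplus>\<^bsub>L\<^esub> h d"
    and k: "\<And>c. c \<in> carrier Te \<Longrightarrow> k c \<in> carrier L"
      "\<And>c d. c \<in> carrier Te \<Longrightarrow> d \<in> carrier Te \<Longrightarrow> k (c \<oplus>\<^bsub>Te\<^esub> d) = k c \<oplus>\<^bsub>L\<^esub> k d"
    and eq: "\<And>m x. m \<in> carrier M \<Longrightarrow> x \<in> carrier X \<Longrightarrow> h (pure m x) = k (pure m x)"
  shows "h c = k c"
  using c
proof (induction rule: tensor_induct)
  case zero
  then show ?case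
    using additive_zero[OF abelian_group_tensor L, of h] additive_zero[OF abelian_group_tensor L, of k]
      h k by simp
next
  case (minus a)
  then show ?case
    using additive_minus[OF abelian_group_tensor L, of h] additive_minus[OF abelian_group_tensor L, of k]
      h k by simp
qed (use h k eq in auto)

end

text \<open>One statement for two uses: with \<open>h\<close> the identity it computes the scalar
  action on a tensor product, with \<open>a\<close> the identity it computes
  \<open>1 \<otimes> h\<close>.\<close>

lemma pres_map_pure:
  assumes "tensor_product R M X" "tensor_product R M' Y"
    and a: "\<And>m. m \<in> carrier M \<Longrightarrow> a m \<in> carrier M'"
      "\<And>m m'. m \<in> carrier M \<Longrightarrow> m' \<in> carrier M \<Longrightarrow> a (m \<oplus>\<^bsub>M\<^esub> m') = a m \<oplus>\<^bsub>M'\<^esub> a m'"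
      "\<And>m r. m \<in> carrier M \<Longrightarrow> r \<in> carrier R \<Longrightarrow> a (rsmult M m r) = rsmult M' (a m) r"
    and h: "h \<in> lmod_hom R X Y"
    and m: "m \<in> carrier M" and x: "x \<in> carrier X"
  shows "pres_map (carrier M' \<times> carrier Y) (tensor_rels R M' Y) (\<lambda>(m, x). (a m, h x))
      (pure_tensor R M X m x) = pure_tensor R M' Y (a m) (h x)"
proof -
  interpret A: tensor_product R M X by fact
  interpret B: tensor_product R M' Y by fact
  have "pres_map (carrier M' \<times> carrier Y) (tensor_rels R M' Y) (\<lambda>(m, x). (a m, h x))
      (A.cl (frag_of (m, x))) = B.cl (frag_extend (\<lambda>z. frag_of (case z of (m, x) \<Rightarrow> (a m, h x))) (frag_of (m, x)))"
  proof (rule pres_map_class[OF A.presentation_axioms B.presentation_axioms])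
    show "(\<lambda>(m, x). (a m, h x)) \<in> carrier M \<times> carrier X \<rightarrow> carrier M' \<times> carrier Y"
      using a(1) lmod_hom_closed[OF h] by auto
    show "Poly_Mapping.keys (frag_of (m, x)) \<subseteq> carrier M \<times> carrier X"
      using m x by (simp add: keys_frag_of)
    fix f assume "f \<in> tensor_rels R M X"
    then have "frag_extend (\<lambda>z. frag_of (case z of (m, x) \<Rightarrow> (a m, h x))) f \<in> tensor_rels R M' Y"
      unfolding tensor_rels_def
      by (elim UnE CollectE exE conjE; simp add: frag_extend_diff a lmod_hom_add[OF h] lmod_hom_smult[OF h];
          use a(1) lmod_hom_closed[OF h] in blast)
    then show "frag_extend (\<lambda>z. frag_of (case z of (m, x) \<Rightarrow> (a m, h x))) f \<in> B.K"
      by (rule B.rels_in_K)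
  qed
  then show ?thesis by (simp add: pure_tensor_def)
qed

section \<open>Modules over the tensor ring\<close>

definition inflate :: "('r, 'm) module \<Rightarrow> ('r \<times> 'b, 'm) module"
  where "inflate L = \<lparr>carrier = carrier L, monoid.mult = undefined, one = undefined,
    ring.zero = \<zero>\<^bsub>L\<^esub>, ring.add = ring.add L, smult = (\<lambda>t x. fst t \<odot>\<^bsub>L\<^esub> x)\<rparr>"

lemma inflate_simps [simp]:
  "carrier (inflate L) = carrier L" "\<zero>\<^bsub>inflate L\<^esub> = \<zero>\<^bsub>L\<^esub>" "add (inflate L) = add L"
  "t \<odot>\<^bsub>inflate L\<^esub> x = fst t \<odot>\<^bsub>L\<^esub> x"
  by (simp_all add: inflate_def)

text \<open>The criterion \<open>Gen_iff\<close> quantifies over additive subgroups rather than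
  submodules; therefore it is insensitive to the change of scalars.\<close>

lemma subgroup_inflate: "subgroup H (add_monoid (inflate L)) \<longleftrightarrow> subgroup H (add_monoid L)"
  by (simp add: subgroup_def m_inv_def)

text \<open>That \<open>T\<^sub>R(N)\<close> is a ring is assumed here because in the theorem it is part of the
  hypothesis that there is a projective presentation.\<close>

locale tensor_ring_over = R: ring R + N: bimodule R R N + T: ring "tensor_ring R N"
  for R :: "'r ring" and N :: "('r, 'r, 'n) bimodule"
begin

abbreviation T where "T \<equiv> tensor_ring R N"
abbreviation M' where "M' \<equiv> tplus R N"
abbreviation emb where "emb r \<equiv> (r, \<zero>\<^bsub>M'\<^esub>)"

lemma T_simps:
  "carrier T = carrier R \<times> carrier M'" "\<one>\<^bsub>T\<^esub> = emb \<one>\<^bsub>R\<^esub>" "\<zero>\<^bsub>T\<^esub> = emb \<zero>\<^bsub>R\<^esub>"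
  by (simp_all add: tensor_ring_def Let_def)

lemma fst_T_simps [simp]:
  "fst \<one>\<^bsub>T\<^esub> = \<one>\<^bsub>R\<^esub>" "fst \<zero>\<^bsub>T\<^esub> = \<zero>\<^bsub>R\<^esub>"
  "fst (s \<oplus>\<^bsub>T\<^esub> t) = fst s \<oplus>\<^bsub>R\<^esub> fst t" "fst (s \<otimes>\<^bsub>T\<^esub> t) = fst s \<otimes>\<^bsub>R\<^esub> fst t"
  by (simp_all add: tensor_ring_def Let_def case_prod_unfold)

lemma snd_add: "snd (s \<oplus>\<^bsub>T\<^esub> t) = snd s \<oplus>\<^bsub>M'\<^esub> snd t"
  by (simp add: tensor_ring_def Let_def case_prod_unfold)

text \<open>Read off from the ring axioms of \<open>T\<close>, whose second component is
  \<open>M'\<close>.\<close>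

lemma zero_M'_closed [simp]: "\<zero>\<^bsub>M'\<^esub> \<in> carrier M'"
  using T.zero_closed by (simp add: T_simps)

lemma fst_closed: "t \<in> carrier T \<Longrightarrow> fst t \<in> carrier R"
  by (auto simp: T_simps)

lemma emb_closed: "r \<in> carrier R \<Longrightarrow> emb r \<in> carrier T"
  by (simp add: T_simps)

lemma inflate_left_module:
  assumes "left_module R L"
  shows "left_module T (inflate L)"
proof -
  interpret L: left_module R L by fact
  have "abelian_group (inflate L)"
    by (rule abelian_groupI) (auto simp: L.M.a_ac intro!: bexI[of _ "\<ominus>\<^bsub>L\<^esub> _"] L.M.l_neg)
  then show ?thesis
    by (intro left_module.intro left_module_axioms.intro T.ring_axioms)
      (auto dest!: fst_closed simp: L.lsmult_closed L.lsmult_l_distr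
        L.lsmult_r_distr L.lsmult_assoc L.lsmult_one)
qed

lemma tr_bimodule_simps:
  "carrier (tr_bimodule R N) = carrier T" "add (tr_bimodule R N) = add T"
  "smult (tr_bimodule R N) = monoid.mult T" "rsmult (tr_bimodule R N) t r = t \<otimes>\<^bsub>T\<^esub> emb r"
  by (simp_all add: tr_bimodule_def module.extend_def bimodule.fields_def regular_module_def)

lemma aug_bimodule_simps:
  "carrier (aug_bimodule R) = carrier R" "add (aug_bimodule R) = add R"
  "smult (aug_bimodule R) = monoid.mult R" "rsmult (aug_bimodule R) r t = r \<otimes>\<^bsub>R\<^esub> fst t"
  by (simp_all add: aug_bimodule_def module.extend_def bimodule.fields_def regular_module_def)

end

section \<open>The induced module \<open>l(P)\<close>, its unit and its counit\<close>

locale induced_module = tensor_ring_over R N + P: left_module R P + lP: left_module "tensor_ring R N" "l_obj R N P"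
  for R :: "'r ring" and N :: "('r, 'r, 'n) bimodule" and P :: "('r, 'p) module"
begin

sublocale tp: tensor_product R "tr_bimodule R N" P
  by unfold_locales (simp_all add: tr_bimodule_simps P.lsmult_closed add: emb_closed)

abbreviation lP where "lP \<equiv> l_obj R N P"

abbreviation pure where "pure \<equiv> pure_tensor R (tr_bimodule R N) P"

abbreviation unit where "unit \<equiv> pure \<one>\<^bsub>T\<^esub>"

lemma lP_eq: "lP = tp.Te"
  by (simp add: l_obj_def)

lemma smult_pure:
  assumes "t \<in> carrier T" "s \<in> carrier T" "p \<in> carrier P"
  shows "t \<odot>\<^bsub>lP\<^esub> pure s p = pure (t \<otimes>\<^bsub>T\<^esub> s) p"
proof -
  have "(\<lambda>x. x) \<in> lmod_hom R P P" by (rule lmod_homI) auto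
  then have "pres_map (carrier (tr_bimodule R N) \<times> carrier P) (tensor_rels R (tr_bimodule R N) P)
      (\<lambda>(m, x). (t \<otimes>\<^bsub>T\<^esub> m, x)) (pure s p) = pure (t \<otimes>\<^bsub>T\<^esub> s) p"
    using assms by (intro pres_map_pure[OF tp.tensor_product_axioms tp.tensor_product_axioms])
      (simp_all add: tr_bimodule_simps T.r_distr T.m_assoc emb_closed)
  then show ?thesis by (simp add: l_obj_def tensor_def Let_def tr_bimodule_simps)
qed

lemma pure_closed: "t \<in> carrier T \<Longrightarrow> p \<in> carrier P \<Longrightarrow> pure t p \<in> carrier lP"
  using tp.pure_closed by (simp add: lP_eq tr_bimodule_simps)

lemma unit_closed: "p \<in> carrier P \<Longrightarrow> unit p \<in> carrier lP"
  by (rule pure_closed) (rule T.one_closed)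

lemma pure_eq: "t \<in> carrier T \<Longrightarrow> p \<in> carrier P \<Longrightarrow> pure t p = t \<odot>\<^bsub>lP\<^esub> unit p"
  by (simp only: smult_pure T.one_closed T.r_one)

lemma unit_add:
  "p \<in> carrier P \<Longrightarrow> p' \<in> carrier P \<Longrightarrow> unit (p \<oplus>\<^bsub>P\<^esub> p') = unit p \<oplus>\<^bsub>lP\<^esub> unit p'"
  using tp.pure_add_right[of "\<one>\<^bsub>T\<^esub>" p p'] T.one_closed
  by (simp add: lP_eq tr_bimodule_simps)

text \<open>Balancing moves \<open>r\<close> across the tensor sign to the right of the identity of
  \<open>T\<close>, where it becomes \<open>emb r\<close>. So \<open>unit\<close> is linear along
  the inclusion of \<open>R\<close>.\<close>

lemma unit_smult:
  assumes r: "r \<in> carrier R" and p: "p \<in> carrier P"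
  shows "unit (r \<odot>\<^bsub>P\<^esub> p) = emb r \<odot>\<^bsub>lP\<^esub> unit p"
proof -
  have "unit (r \<odot>\<^bsub>P\<^esub> p) = pure (\<one>\<^bsub>T\<^esub> \<otimes>\<^bsub>T\<^esub> emb r) p"
    using tp.pure_balanced[of "\<one>\<^bsub>T\<^esub>" r p] r p T.one_closed
    by (simp add: tr_bimodule_simps)
  also have "\<dots> = emb r \<odot>\<^bsub>lP\<^esub> unit p"
    using pure_eq[OF emb_closed[OF r] p] T.l_one[OF emb_closed[OF r]] by simp
  finally show ?thesis .
qed

lemma lP_induct [consumes 1, case_names zero add minus pure]:
  assumes "c \<in> carrier lP" and "P' \<zero>\<^bsub>lP\<^esub>"
    and "\<And>a b. a \<in> carrier lP \<Longrightarrow> b \<in> carrier lP \<Longrightarrow> P' a \<Longrightarrow> P' b \<Longrightarrow> P' (a \<oplus>\<^bsub>lP\<^esub> b)"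
    and "\<And>a. a \<in> carrier lP \<Longrightarrow> P' a \<Longrightarrow> P' (\<ominus>\<^bsub>lP\<^esub> a)"
    and "\<And>t p. t \<in> carrier T \<Longrightarrow> p \<in> carrier P \<Longrightarrow> P' (t \<odot>\<^bsub>lP\<^esub> unit p)"
  shows "P' c"
  using assms(1) unfolding lP_eq
proof (induction rule: tp.tensor_induct)
  case (pure t p)
  then show ?case using pure_eq[of t p] assms(5)[of t p] by (simp only: tr_bimodule_simps)
qed (use assms in \<open>simp_all only: lP_eq\<close>)

text \<open>The elements \<open>unit p\<close> generate \<open>l(P)\<close> over
  \<open>T\<close>.\<close>

lemma lP_hom_eq:
  assumes F: "F \<in> lmod_hom T lP Y" and G: "G \<in> lmod_hom T lP Y" and Y: "abelian_group Y"
    and eq: "\<And>p. p \<in> carrier P \<Longrightarrow> F (unit p) = G (unit p)" and c: "c \<in> carrier lP"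
  shows "F c = G c"
  using c
proof (induction rule: lP_induct)
  case zero
  then show ?case
    using lmod_hom_zero[OF F lP.M.abelian_group_axioms Y]
      lmod_hom_zero[OF G lP.M.abelian_group_axioms Y] by simp
next
  case (add a b)
  then show ?case by (simp add: lmod_hom_add[OF F] lmod_hom_add[OF G])
next
  case (minus a)
  then show ?case
    using lmod_hom_minus[OF F lP.M.abelian_group_axioms Y]
      lmod_hom_minus[OF G lP.M.abelian_group_axioms Y] by simp
next
  case (pure t p)
  then show ?case
    using lmod_hom_smult[OF F pure(1) unit_closed[OF pure(2)]]
      lmod_hom_smult[OF G pure(1) unit_closed[OF pure(2)]] eq by simp
qed

text \<open>Under the identification of \<open>q (l P)\<close> with \<open>P\<close> this is the
  canonical map \<open>y \<mapsto> 1 \<otimes> y\<close>; \<open>pure_one_eq_ql_iso\<close> makes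
  that precise. It is a choice because the universal property yields existence only.\<close>

definition counit where
  "counit = (SOME h. h \<in> lmod_hom T lP (inflate P) \<and>
    (\<forall>t\<in>carrier T. \<forall>p\<in>carrier P. h (t \<odot>\<^bsub>lP\<^esub> unit p) = fst t \<odot>\<^bsub>P\<^esub> p))"

lemma counit_ex:
  "\<exists>h. h \<in> lmod_hom T lP (inflate P) \<and>
    (\<forall>t\<in>carrier T. \<forall>p\<in>carrier P. h (t \<odot>\<^bsub>lP\<^esub> unit p) = fst t \<odot>\<^bsub>P\<^esub> p)"
proof -
  obtain h where h: "\<And>c. c \<in> carrier tp.Te \<Longrightarrow> h c \<in> carrier P"
    "\<And>c d. c \<in> carrier tp.Te \<Longrightarrow> d \<in> carrier tp.Te \<Longrightarrow> h (c \<oplus>\<^bsub>tp.Te\<^esub> d) = h c \<oplus>\<^bsub>P\<^esub> h d"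
    "\<And>t p. t \<in> carrier (tr_bimodule R N) \<Longrightarrow> p \<in> carrier P \<Longrightarrow> h (pure t p) = fst t \<odot>\<^bsub>P\<^esub> p"
    by (rule tp.tensor_universal[of P "\<lambda>t p. fst t \<odot>\<^bsub>P\<^esub> p"])
      (auto simp: tr_bimodule_simps P.M.abelian_group_axioms P.lsmult_closed P.lsmult_l_distr
        P.lsmult_r_distr P.lsmult_assoc dest!: fst_closed[of "(_, _)", simplified])
  note h = h[folded lP_eq, unfolded tr_bimodule_simps]
  have hu: "h (t \<odot>\<^bsub>lP\<^esub> unit p) = fst t \<odot>\<^bsub>P\<^esub> p" if "t \<in> carrier T" "p \<in> carrier P" for t p
    using h(3)[OF that] pure_eq[OF that] by simp
  \<comment> \<open>Linearity over \<open>T\<close> by induction on \<open>c\<close>: on generators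
    it is associativity of the two actions, since the augmentation \<open>fst\<close> is
    multiplicative.\<close>
  have "h (t \<odot>\<^bsub>lP\<^esub> c) = fst t \<odot>\<^bsub>P\<^esub> h c" if t: "t \<in> carrier T" and c: "c \<in> carrier lP" for t c
    using c
  proof (induction rule: lP_induct)
    case zero
    have "h \<zero>\<^bsub>lP\<^esub> = \<zero>\<^bsub>P\<^esub>"
      using additive_zero[of lP P h] h lP.M.abelian_group_axioms P.M.abelian_group_axioms by blast
    then show ?case using t fst_closed by (simp add: lP.lsmult_r_null P.lsmult_r_null)
  next
    case (add a b)
    then show ?case
      using t fst_closed h(1)
      by (simp add: lP.lsmult_r_distr P.lsmult_r_distr h(2) lP.lsmult_closed)
  next
    case (minus a)
    have "h (t \<odot>\<^bsub>lP\<^esub> (\<ominus>\<^bsub>lP\<^esub> a)) = \<ominus>\<^bsub>P\<^esub> h (t \<odot>\<^bsub>lP\<^esub> a)"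
      using minus t by (intro additive_minus[of lP P "\<lambda>c. h (t \<odot>\<^bsub>lP\<^esub> c)"])
        (simp_all add: h lP.lsmult_closed lP.lsmult_r_distr lP.M.abelian_group_axioms
          P.M.abelian_group_axioms)
    moreover have "fst t \<odot>\<^bsub>P\<^esub> h (\<ominus>\<^bsub>lP\<^esub> a) = \<ominus>\<^bsub>P\<^esub> (fst t \<odot>\<^bsub>P\<^esub> h a)"
      using minus t by (intro additive_minus[of lP P "\<lambda>c. fst t \<odot>\<^bsub>P\<^esub> h c"])
        (simp_all add: h P.lsmult_closed P.lsmult_r_distr lP.M.abelian_group_axioms
          P.M.abelian_group_axioms fst_closed)
    ultimately show ?case using minus by simp
  next
    case (pure s p)
    have "t \<odot>\<^bsub>lP\<^esub> (s \<odot>\<^bsub>lP\<^esub> unit p) = (t \<otimes>\<^bsub>T\<^esub> s) \<odot>\<^bsub>lP\<^esub> unit p"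
      using lP.lsmult_assoc[OF t pure(1) unit_closed[OF pure(2)]] by simp
    then show ?case
      using hu[OF T.m_closed[OF t pure(1)] pure(2)] hu[OF pure]
        P.lsmult_assoc[OF fst_closed[OF t] fst_closed[OF pure(1)] pure(2)] by simp
  qed
  then have "h \<in> lmod_hom T lP (inflate P)"
    by (intro lmod_homI) (simp_all add: h)
  then show ?thesis using hu by blast
qed

lemma
  shows counit_hom: "counit \<in> lmod_hom T lP (inflate P)"
    and counit_smult_unit:
      "t \<in> carrier T \<Longrightarrow> p \<in> carrier P \<Longrightarrow> counit (t \<odot>\<^bsub>lP\<^esub> unit p) = fst t \<odot>\<^bsub>P\<^esub> p"
  using someI_ex[OF counit_ex] by (auto simp: counit_def)

lemma counit_closed: "c \<in> carrier lP \<Longrightarrow> counit c \<in> carrier P"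
  using lmod_hom_closed[OF counit_hom] by simp

lemma counit_add:
  "c \<in> carrier lP \<Longrightarrow> d \<in> carrier lP \<Longrightarrow> counit (c \<oplus>\<^bsub>lP\<^esub> d) = counit c \<oplus>\<^bsub>P\<^esub> counit d"
  using lmod_hom_add[OF counit_hom] by simp

lemma counit_zero: "counit \<zero>\<^bsub>lP\<^esub> = \<zero>\<^bsub>P\<^esub>"
  by (rule additive_zero[of lP P counit])
    (simp_all add: lP.M.abelian_group_axioms P.M.abelian_group_axioms counit_closed counit_add)

lemma counit_minus: "c \<in> carrier lP \<Longrightarrow> counit (\<ominus>\<^bsub>lP\<^esub> c) = \<ominus>\<^bsub>P\<^esub> counit c"
  by (rule additive_minus[of lP P counit])
    (simp_all add: lP.M.abelian_group_axioms P.M.abelian_group_axioms counit_closed counit_add)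

lemma counit_unit:
  assumes "p \<in> carrier P"
  shows "counit (unit p) = p"
  using counit_smult_unit[OF T.one_closed assms] lP.lsmult_one[OF unit_closed[OF assms]] assms
  by (simp add: P.lsmult_one)

lemma hom_unit:
  assumes F: "F \<in> lmod_hom T lP (inflate L)"
  shows "(\<lambda>p. F (unit p)) \<in> lmod_hom R P L"
proof (rule lmod_homI)
  show "F (unit (r \<odot>\<^bsub>P\<^esub> p)) = r \<odot>\<^bsub>L\<^esub> F (unit p)" if "r \<in> carrier R" "p \<in> carrier P" for r p
    using lmod_hom_smult[OF F emb_closed[OF that(1)] unit_closed[OF that(2)]] unit_smult[OF that]
    by simp
qed (use lmod_hom_closed[OF F unit_closed] lmod_hom_add[OF F unit_closed unit_closed] unit_add
    in simp_all)

lemma hom_counit: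
  assumes g: "g \<in> lmod_hom R P L"
  shows "(\<lambda>c. g (counit c)) \<in> lmod_hom T lP (inflate L)"
proof (rule lmod_homI)
  show "g (counit (t \<odot>\<^bsub>lP\<^esub> c)) = t \<odot>\<^bsub>inflate L\<^esub> g (counit c)"
    if "t \<in> carrier T" "c \<in> carrier lP" for t c
    using lmod_hom_smult[OF counit_hom that] lmod_hom_smult[OF g fst_closed counit_closed] that
    by simp
qed (simp_all add: lmod_hom_closed[OF g] lmod_hom_add[OF g] counit_closed counit_add)

text \<open>Restriction along \<open>unit\<close> and composition with \<open>counit\<close> are
  inverse to each other: both sides are \<open>T\<close>-linear in \<open>c\<close>, and they agree
  on \<open>unit p\<close> because \<open>counit (unit p) = p\<close>.\<close>

lemma hom_factor_counit:
  assumes F: "F \<in> lmod_hom T lP (inflate L)" and L: "left_module R L" and c: "c \<in> carrier lP"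
  shows "F c = F (unit (counit c))"
  by (rule lP_hom_eq[OF F hom_counit[OF hom_unit[OF F]] _ _ c])
    (simp_all add: counit_unit inflate_left_module[OF L, THEN left_module.axioms(2)])

sublocale q: tensor_product T "aug_bimodule R" lP
  by unfold_locales (simp_all add: aug_bimodule_simps lP.lsmult_closed fst_closed)

text \<open>Over \<open>T\<close>, the element \<open>1 \<otimes> (t \<otimes> p)\<close> equals
  \<open>fst t \<otimes> (1 \<otimes> p)\<close> and so depends on \<open>t\<close> only through
  \<open>fst t\<close>. Hence \<open>t\<close> may be replaced by \<open>emb (fst t)\<close>, and
  \<open>unit_smult\<close> moves this scalar into \<open>P\<close>.\<close>

lemma pure_one_eq_ql_iso:
  assumes y: "y \<in> carrier lP"
  shows "q.pure \<one>\<^bsub>R\<^esub> y = ql_iso R N P (counit y)"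
proof -
  have "q.pure \<one>\<^bsub>R\<^esub> y = q.pure \<one>\<^bsub>R\<^esub> (unit (counit y))"
    using y
  proof (rule tp.tensor_additive_eq[OF q.abelian_group_tensor, folded lP_eq])
    show "q.pure \<one>\<^bsub>R\<^esub> c \<in> carrier q.Te" if "c \<in> carrier lP" for c
      using that by (simp add: q.pure_closed aug_bimodule_simps)
    show "q.pure \<one>\<^bsub>R\<^esub> (c \<oplus>\<^bsub>lP\<^esub> d) = q.pure \<one>\<^bsub>R\<^esub> c \<oplus>\<^bsub>q.Te\<^esub> q.pure \<one>\<^bsub>R\<^esub> d"
      if "c \<in> carrier lP" "d \<in> carrier lP" for c d
      using that by (simp add: q.pure_add_right aug_bimodule_simps)
    show "q.pure \<one>\<^bsub>R\<^esub> (unit (counit c)) \<in> carrier q.Te" if "c \<in> carrier lP" for c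
      using unit_closed[OF counit_closed[OF that]] by (simp add: q.pure_closed aug_bimodule_simps)
    show "q.pure \<one>\<^bsub>R\<^esub> (unit (counit (c \<oplus>\<^bsub>lP\<^esub> d)))
        = q.pure \<one>\<^bsub>R\<^esub> (unit (counit c)) \<oplus>\<^bsub>q.Te\<^esub> q.pure \<one>\<^bsub>R\<^esub> (unit (counit d))"
      if "c \<in> carrier lP" "d \<in> carrier lP" for c d
      using unit_closed[OF counit_closed[OF that(1)]] unit_closed[OF counit_closed[OF that(2)]]
        unit_add[OF counit_closed[OF that(1)] counit_closed[OF that(2)]]
      by (simp add: q.pure_add_right aug_bimodule_simps counit_add that)
    show "q.pure \<one>\<^bsub>R\<^esub> (pure t p) = q.pure \<one>\<^bsub>R\<^esub> (unit (counit (pure t p)))"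
      if "t \<in> carrier (tr_bimodule R N)" and p: "p \<in> carrier P" for t p
    proof -
      have t: "t \<in> carrier T" using that by (simp add: tr_bimodule_simps)
      have bal: "q.pure \<one>\<^bsub>R\<^esub> (s \<odot>\<^bsub>lP\<^esub> unit p) = q.pure (fst s) (unit p)" if s: "s \<in> carrier T" for s
        using q.pure_balanced[of "\<one>\<^bsub>R\<^esub>" s "unit p"] s unit_closed[OF p] fst_closed[OF s]
        by (simp add: aug_bimodule_simps)
      have "q.pure \<one>\<^bsub>R\<^esub> (pure t p) = q.pure \<one>\<^bsub>R\<^esub> (emb (fst t) \<odot>\<^bsub>lP\<^esub> unit p)"
        using bal[OF t] bal[OF emb_closed[OF fst_closed[OF t]]] pure_eq[OF t p] by simp
      then show ?thesis
        using unit_smult[OF fst_closed[OF t] p] counit_smult_unit[OF t p] pure_eq[OF t p] by simp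
    qed
  qed
  then show ?thesis by (simp add: ql_iso_def)
qed

text \<open>The additive map \<open>r \<otimes> y \<mapsto> r (counit y)\<close> is a left
  inverse.\<close>

lemma inj_ql_iso: "inj_on (ql_iso R N P) (carrier P)"
proof -
  obtain h where h: "\<And>r y. r \<in> carrier (aug_bimodule R) \<Longrightarrow> y \<in> carrier lP \<Longrightarrow>
      h (q.pure r y) = r \<odot>\<^bsub>P\<^esub> counit y"
    by (rule q.tensor_universal[of P "\<lambda>r y. r \<odot>\<^bsub>P\<^esub> counit y"])
      (auto simp: aug_bimodule_simps P.M.abelian_group_axioms P.lsmult_closed P.lsmult_l_distr
        P.lsmult_r_distr P.lsmult_assoc counit_closed counit_add lmod_hom_smult[OF counit_hom]
        fst_closed)
  have "h (ql_iso R N P p) = p" if "p \<in> carrier P" for p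
    using h[OF _ unit_closed[OF that], of "\<one>\<^bsub>R\<^esub>"] that
    by (simp add: ql_iso_def aug_bimodule_simps counit_unit P.lsmult_one)
  then show ?thesis by (rule inj_on_inverseI)
qed

end

text \<open>Removes the tensor product over \<open>T\<close> from \<open>q(\<delta>)\<close>:
  \<open>1 \<otimes> unit p\<close> goes to \<open>1 \<otimes> \<delta> (unit p)\<close>, which
  \<open>pure_one_eq_ql_iso\<close> exhibits as a value of \<open>ql_iso\<close>; by injectivity
  \<open>inv_into\<close> returns its argument.\<close>

lemma q_delta_eq:
  assumes "induced_module R N P1" "induced_module R N P0"
    and \<delta>: "\<delta> \<in> lmod_hom (tensor_ring R N) (l_obj R N P1) (l_obj R N P0)" and p: "p \<in> carrier P1"
  shows "q_delta R N P1 P0 \<delta> p = induced_module.counit R N P0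
    (\<delta> (pure_tensor R (tr_bimodule R N) P1 \<one>\<^bsub>tensor_ring R N\<^esub> p))"
proof -
  interpret A: induced_module R N P1 by fact
  interpret B: induced_module R N P0 by fact
  have "q_map R N B.lP \<delta> (A.q.pure \<one>\<^bsub>R\<^esub> (A.unit p)) = B.q.pure \<one>\<^bsub>R\<^esub> (\<delta> (A.unit p))"
    unfolding q_map_def tensor_map_def
    using A.unit_closed[OF p]
    by (intro pres_map_pure[OF A.q.tensor_product_axioms B.q.tensor_product_axioms _ _ _ \<delta>])
      (simp_all add: A.aug_bimodule_simps)
  then have "q_map R N B.lP \<delta> (ql_iso R N P1 p) = ql_iso R N P0 (B.counit (\<delta> (A.unit p)))"
    using B.pure_one_eq_ql_iso[OF lmod_hom_closed[OF \<delta> A.unit_closed[OF p]]]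
    by (simp add: ql_iso_def)
  then show ?thesis
    unfolding q_delta_def
    using inv_into_f_f[OF B.inj_ql_iso B.counit_closed[OF lmod_hom_closed[OF \<delta> A.unit_closed[OF p]]]]
    by simp
qed

section \<open>The right action of \<open>R\<close> on the tensor powers of \<open>N\<close> and on
  \<open>M'\<close>\<close>

context tensor_ring_over
begin

lemma presentation_tpow: "presentation (words N n) (tpow_rels R N n)"
proof
  have d: "Poly_Mapping.keys (frag_of a - frag_of b) \<subseteq> {a, b}" for a b :: "'n list"
    using keys_diff[of "frag_of a" "frag_of b"] by (auto simp: keys_frag_of)
  have d3: "Poly_Mapping.keys (frag_of a - frag_of b - frag_of c) \<subseteq> {a, b, c}" for a b c :: "'n list"
    using keys_diff[of "frag_of a - frag_of b" "frag_of c"] d[of a b] by (auto simp: keys_frag_of)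
  show "f \<in> tpow_rels R N n \<Longrightarrow> Poly_Mapping.keys f \<subseteq> words N n" for f
    unfolding tpow_rels_def
    by (elim UnE CollectE exE conjE; simp only:; rule order_trans[OF d] order_trans[OF d3];
        simp add: words_def N.rsmult_closed N.lsmult_closed)
qed

text \<open>The action changes the last letter only. If \<open>v\<close> is empty, that letter takes
  part in the relation, which survives by distributivity or by \<open>(s y) r = s (y r)\<close>;
  otherwise the change happens inside \<open>v\<close> and the relator keeps its shape.\<close>

lemma rsmult_tpow_rels:
  assumes f: "f \<in> tpow_rels R N n" and r: "r \<in> carrier R"
  shows "frag_extend (\<lambda>w. frag_of (butlast w @ [rsmult N (last w) r])) f \<in> tpow_rels R N n"
    (is "?F f \<in> _")
proof -
  consider u v x y where "f = frag_of (u @ [x \<oplus>\<^bsub>N\<^esub> y] @ v) - frag_of (u @ [x] @ v) - frag_of (u @ [y] @ v)"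
      "u @ [x] @ v \<in> words N n" "y \<in> carrier N"
    | u v x y s where "f = frag_of (u @ [rsmult N x s, y] @ v) - frag_of (u @ [x, s \<odot>\<^bsub>N\<^esub> y] @ v)"
      "u @ [x, y] @ v \<in> words N n" "s \<in> carrier R"
    using f unfolding tpow_rels_def by blast
  then show ?thesis
  proof cases
    case 1
    obtain v' x' y' where "?F f = frag_of (u @ [x' \<oplus>\<^bsub>N\<^esub> y'] @ v') - frag_of (u @ [x'] @ v') - frag_of (u @ [y'] @ v')"
      "u @ [x'] @ v' \<in> words N n" "y' \<in> carrier N"
    proof (cases v rule: rev_cases)
      case Nil
      with 1 r show ?thesis
        by (intro that[of "rsmult N x r" "rsmult N y r" "[]"])
          (auto simp: frag_extend_diff words_def N.rsmult_l_distr N.rsmult_closed)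
    next
      case (snoc v' z)
      with 1 r show ?thesis
        by (intro that[of x y "v' @ [rsmult N z r]"])
          (auto simp: frag_extend_diff words_def N.rsmult_closed butlast_append)
    qed
    then show ?thesis unfolding tpow_rels_def by blast
  next
    case 2
    obtain v' y' where "?F f = frag_of (u @ [rsmult N x s, y'] @ v') - frag_of (u @ [x, s \<odot>\<^bsub>N\<^esub> y'] @ v')"
      "u @ [x, y'] @ v' \<in> words N n"
    proof (cases v rule: rev_cases)
      case Nil
      with 2 r show ?thesis
        by (intro that[of "rsmult N y r" "[]"])
          (auto simp: frag_extend_diff words_def N.smult_rsmult N.rsmult_closed butlast_append)
    next
      case (snoc v' z)
      with 2 r show ?thesis
        by (intro that[of y "v' @ [rsmult N z r]"])
          (auto simp: frag_extend_diff words_def N.rsmult_closed butlast_append)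
    qed
    with 2(3) show ?thesis unfolding tpow_rels_def by blast
  qed
qed

lemma
  assumes n: "1 \<le> n" and r: "r \<in> carrier R"
  shows rsmult_tpow_closed:
      "c \<in> carrier (tpow R N n) \<Longrightarrow> rsmult (tpow R N n) c r \<in> carrier (tpow R N n)"
    and rsmult_tpow_zero: "rsmult (tpow R N n) \<zero>\<^bsub>tpow R N n\<^esub> r = \<zero>\<^bsub>tpow R N n\<^esub>"
proof -
  interpret P: presentation "words N n" "tpow_rels R N n" by (rule presentation_tpow)
  let ?\<phi> = "\<lambda>w. butlast w @ [rsmult N (last w) r]"
  have \<phi>: "?\<phi> \<in> words N n \<rightarrow> words N n"
  proof
    fix w assume w: "w \<in> words N n"
    \<comment> \<open>Degree at least 1 is what provides a last letter to act on.\<close>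
    then have "w \<noteq> []" using n by (auto simp: words_def)
    with w r n show "?\<phi> w \<in> words N n"
      by (auto simp: words_def N.rsmult_closed subset_iff dest: in_set_butlastD)
  qed
  have cl: "rsmult (tpow R N n) (P.cl f) r = P.cl (frag_extend (\<lambda>w. frag_of (?\<phi> w)) f)"
    if "Poly_Mapping.keys f \<subseteq> words N n" for f
    using pres_map_class[OF P.presentation_axioms P.presentation_axioms \<phi> _ that]
      P.rels_in_K rsmult_tpow_rels[OF _ r]
    by (simp add: tpow_def Let_def)
  have keys: "Poly_Mapping.keys (frag_extend (\<lambda>w. frag_of (?\<phi> w)) f) \<subseteq> words N n"
    if "Poly_Mapping.keys f \<subseteq> words N n" for f
    using keys_frag_extend[of "\<lambda>w. frag_of (?\<phi> w)" f] that \<phi> by (fastforce simp: keys_frag_of)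
  have carr: "carrier (tpow R N n) = carrier P.G" and zero: "\<zero>\<^bsub>tpow R N n\<^esub> = P.cl 0"
    by (simp_all add: tpow_def Let_def P.cl_zero)
  show "rsmult (tpow R N n) c r \<in> carrier (tpow R N n)" if "c \<in> carrier (tpow R N n)"
    using that cl P.cl_closed[OF keys] by (auto simp: carr P.carrier_pres_group)
  show "rsmult (tpow R N n) \<zero>\<^bsub>tpow R N n\<^esub> r = \<zero>\<^bsub>tpow R N n\<^esub>"
    using cl[of 0] by (simp add: zero)
qed

text \<open>The ring axioms of \<open>T\<close> do not give this at once: the second component of
  \<open>(0, m) (r, 0)\<close> also contains a left action on zero and a \<open>theta\<close> term.
  Closure is therefore checked in each degree, and zero components stay zero, so the support stays
  finite.\<close>

lemma rsmult_M'_closed: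
  assumes m: "m \<in> carrier M'" and r: "r \<in> carrier R"
  shows "rsmult M' m r \<in> carrier M'"
proof -
  have simps: "carrier M' = carrier (dsum {1..} (tpow R N))"
    "rsmult M' m r = (\<lambda>n\<in>{1..}. rsmult (tpow R N n) (m n) r)"
    by (simp_all add: tplus_def module.extend_def bimodule.fields_def dsum_def)
  have "{n \<in> {1..}. rsmult (tpow R N n) (m n) r \<noteq> \<zero>\<^bsub>tpow R N n\<^esub>}
      \<subseteq> {n \<in> {1..}. m n \<noteq> \<zero>\<^bsub>tpow R N n\<^esub>}"
    using rsmult_tpow_zero[OF _ r] by auto
  moreover have "finite {n \<in> {1..}. m n \<noteq> \<zero>\<^bsub>tpow R N n\<^esub>}"
    using m by (simp add: simps dsum_def)
  ultimately have "finite {n \<in> {1..}. rsmult (tpow R N n) (m n) r \<noteq> \<zero>\<^bsub>tpow R N n\<^esub>}"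
    by (rule finite_subset)
  moreover have "rsmult (tpow R N n) (m n) r \<in> carrier (tpow R N n)" if "1 \<le> n" for n
    using m that by (intro rsmult_tpow_closed r) (auto simp: simps dsum_def)
  ultimately show ?thesis
    by (auto simp: simps dsum_def cong: conj_cong)
qed

end

section \<open>The image of \<open>\<alpha>\<close> and the cokernel\<close>

locale tensor_ring_module = tensor_ring_over R N + X: left_module R X
    + XT: left_module "tensor_ring R N" "tr_module R N X \<alpha>"
  for R :: "'r ring" and N :: "('r, 'r, 'n) bimodule" and X :: "('r, 'x) module" and \<alpha> +
  assumes \<alpha>_hom: "\<alpha> \<in> lmod_hom R (tensor R (tplus R N) X) X"
begin

abbreviation XT where "XT \<equiv> tr_module R N X \<alpha>"

sublocale t: tensor_product R M' X
proof
  show "m \<oplus>\<^bsub>M'\<^esub> m' \<in> carrier M'" if "m \<in> carrier M'" "m' \<in> carrier M'" for m m'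
    using T.a_closed[of "emb \<zero>\<^bsub>R\<^esub>" "emb \<zero>\<^bsub>R\<^esub>"] T.a_closed[of "(\<zero>\<^bsub>R\<^esub>, m)" "(\<zero>\<^bsub>R\<^esub>, m')"] that
      snd_add[of "(\<zero>\<^bsub>R\<^esub>, m)" "(\<zero>\<^bsub>R\<^esub>, m')"] by (auto simp: T_simps)
qed (simp_all add: rsmult_M'_closed X.lsmult_closed)

definition im\<alpha> where "im\<alpha> = \<alpha> ` carrier t.Te"

lemma XT_simps [simp]:
  "carrier XT = carrier X" "\<zero>\<^bsub>XT\<^esub> = \<zero>\<^bsub>X\<^esub>" "add XT = add X"
  by (simp_all add: tr_module_def)

lemma XT_smult: "t \<odot>\<^bsub>XT\<^esub> x = fst t \<odot>\<^bsub>X\<^esub> x \<oplus>\<^bsub>X\<^esub> \<alpha> (t.pure (snd t) x)"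
  by (simp add: tr_module_def case_prod_unfold)

lemma XT_minus: "\<ominus>\<^bsub>XT\<^esub> x = \<ominus>\<^bsub>X\<^esub> x"
  by (simp add: a_inv_def m_inv_def)

lemma \<alpha>_closed: "c \<in> carrier t.Te \<Longrightarrow> \<alpha> c \<in> carrier X"
  using lmod_hom_closed[OF \<alpha>_hom] .

lemma \<alpha>_zero: "\<alpha> \<zero>\<^bsub>t.Te\<^esub> = \<zero>\<^bsub>X\<^esub>"
  using lmod_hom_zero[OF \<alpha>_hom t.abelian_group_tensor X.M.abelian_group_axioms] .

lemma \<alpha>_minus: "c \<in> carrier t.Te \<Longrightarrow> \<alpha> (\<ominus>\<^bsub>t.Te\<^esub> c) = \<ominus>\<^bsub>X\<^esub> \<alpha> c"
  using lmod_hom_minus[OF \<alpha>_hom t.abelian_group_tensor X.M.abelian_group_axioms] .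

lemma pair_closed: "m \<in> carrier M' \<Longrightarrow> (\<zero>\<^bsub>R\<^esub>, m) \<in> carrier T"
  by (simp add: T_simps)

lemma \<alpha>_pure:
  assumes "m \<in> carrier M'" "x \<in> carrier X"
  shows "\<alpha> (t.pure m x) = (\<zero>\<^bsub>R\<^esub>, m) \<odot>\<^bsub>XT\<^esub> x"
  using assms \<alpha>_closed[OF t.pure_closed] by (simp add: XT_smult X.lsmult_l_null)

lemma emb_smult:
  assumes r: "r \<in> carrier R" and x: "x \<in> carrier X"
  shows "emb r \<odot>\<^bsub>XT\<^esub> x = r \<odot>\<^bsub>X\<^esub> x"
proof -
  \<comment> \<open>The pair \<open>(0, 0)\<close> is the zero of \<open>T\<close> and annihilates
    \<open>XT\<close>; this removes the \<open>\<alpha>\<close> term from the action of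
    \<open>emb r\<close>.\<close>
  have "\<alpha> (t.pure \<zero>\<^bsub>M'\<^esub> x) = \<zero>\<^bsub>X\<^esub>"
    using \<alpha>_pure[OF zero_M'_closed x] XT.lsmult_l_null[of x] x by (simp add: T_simps)
  then show ?thesis using r x by (simp add: XT_smult X.lsmult_closed)
qed

lemma im\<alpha>_subgroup: "subgroup im\<alpha> (add_monoid X)"
proof (rule group.subgroupI[OF X.M.a_group])
  show "im\<alpha> \<subseteq> carrier (add_monoid X)" using \<alpha>_closed by (auto simp: im\<alpha>_def)
  show "im\<alpha> \<noteq> {}"
    using abelian_monoid.zero_closed[OF abelian_group.axioms(1)[OF t.abelian_group_tensor]]
    by (auto simp: im\<alpha>_def)
  show "inv\<^bsub>add_monoid X\<^esub> a \<in> im\<alpha>" if "a \<in> im\<alpha>" for a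
  proof -
    obtain c where "c \<in> carrier t.Te" "a = \<alpha> c" using \<open>a \<in> im\<alpha>\<close> by (auto simp: im\<alpha>_def)
    then show ?thesis
      using \<alpha>_minus[of c] abelian_group.a_inv_closed[OF t.abelian_group_tensor, of c]
      unfolding im\<alpha>_def a_inv_def by (metis imageI)
  qed
  show "a \<otimes>\<^bsub>add_monoid X\<^esub> b \<in> im\<alpha>" if "a \<in> im\<alpha>" "b \<in> im\<alpha>" for a b
  proof -
    obtain c d where "c \<in> carrier t.Te" "a = \<alpha> c" "d \<in> carrier t.Te" "b = \<alpha> d"
      using \<open>a \<in> im\<alpha>\<close> \<open>b \<in> im\<alpha>\<close> by (auto simp: im\<alpha>_def)
    then show ?thesis
      using lmod_hom_add[OF \<alpha>_hom, of c d]
        abelian_monoid.a_closed[OF abelian_group.axioms(1)[OF t.abelian_group_tensor], of c d]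
      by (auto simp: im\<alpha>_def intro!: image_eqI[of _ \<alpha> "c \<oplus>\<^bsub>t.Te\<^esub> d"])
  qed
qed

text \<open>On pure tensors \<open>\<alpha> (m \<otimes> x) = (0, m) x\<close>, and
  \<open>emb r\<close> times \<open>(0, m)\<close> again has first component zero, so the result is
  again a value of \<open>\<alpha>\<close>. Arguing inside \<open>T\<close> avoids the scalar action
  on the tensor product.\<close>

lemma im\<alpha>_smult:
  assumes r: "r \<in> carrier R" and b: "b \<in> im\<alpha>"
  shows "r \<odot>\<^bsub>X\<^esub> b \<in> im\<alpha>"
proof -
  obtain c where c: "c \<in> carrier t.Te" "b = \<alpha> c" using b by (auto simp: im\<alpha>_def)
  note sub = subgroup.one_closed[OF im\<alpha>_subgroup] subgroup.m_closed[OF im\<alpha>_subgroup]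
    subgroup.m_inv_closed[OF im\<alpha>_subgroup, folded a_inv_def]
  have "r \<odot>\<^bsub>X\<^esub> \<alpha> c \<in> im\<alpha>"
    using c(1)
  proof (induction rule: t.tensor_induct)
    case zero
    then show ?case using r sub by (simp add: \<alpha>_zero X.lsmult_r_null)
  next
    case (add a b)
    then show ?case using r sub(2) by (simp add: lmod_hom_add[OF \<alpha>_hom] \<alpha>_closed X.lsmult_r_distr)
  next
    case (minus a)
    then have "r \<odot>\<^bsub>X\<^esub> \<alpha> (\<ominus>\<^bsub>t.Te\<^esub> a) = \<ominus>\<^bsub>X\<^esub> (r \<odot>\<^bsub>X\<^esub> \<alpha> a)"
      using r additive_minus[of X X "smult X r" "\<alpha> a"]
      by (simp add: \<alpha>_minus \<alpha>_closed X.lsmult_closed X.lsmult_r_distr X.M.abelian_group_axioms)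
    then show ?case using sub(3) minus by simp
  next
    case (pure m x)
    define s where "s = emb r \<otimes>\<^bsub>T\<^esub> (\<zero>\<^bsub>R\<^esub>, m)"
    have s: "s \<in> carrier T"
      unfolding s_def using T.m_closed[OF emb_closed[OF r] pair_closed[OF pure(1)]] .
    have "fst s = \<zero>\<^bsub>R\<^esub>" using r by (simp add: s_def)
    then have s_eq: "s = (\<zero>\<^bsub>R\<^esub>, snd s)" "snd s \<in> carrier M'"
      using s by (auto simp: T_simps prod_eq_iff)
    have "r \<odot>\<^bsub>X\<^esub> \<alpha> (t.pure m x) = emb r \<odot>\<^bsub>XT\<^esub> ((\<zero>\<^bsub>R\<^esub>, m) \<odot>\<^bsub>XT\<^esub> x)"
      using pure r by (simp add: emb_smult \<alpha>_closed t.pure_closed flip: \<alpha>_pure)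
    also have "\<dots> = s \<odot>\<^bsub>XT\<^esub> x"
      using XT.lsmult_assoc[OF emb_closed[OF r] pair_closed[OF pure(1)], of x] pure(2)
      by (simp add: s_def)
    also have "\<dots> = \<alpha> (t.pure (snd s) x)"
      using \<alpha>_pure[OF s_eq(2) pure(2)] s_eq(1) by simp
    finally show ?case using t.pure_closed[OF s_eq(2) pure(2)] by (simp add: im\<alpha>_def)
  qed
  then show ?thesis using c by simp
qed

sublocale C: left_submodule R X im\<alpha>
  by (intro left_submodule.intro left_submodule_axioms.intro X.left_module_axioms im\<alpha>_subgroup im\<alpha>_smult)

lemma coker_eq: "coker R N X \<alpha> = C.Q"
  by (simp add: coker_def im\<alpha>_def)

text \<open>The \<open>M'\<close> part of the action has values in \<open>im\<alpha>\<close> and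
  dies in the quotient.\<close>

lemma cls_smult_T:
  assumes t: "t \<in> carrier T" and x: "x \<in> carrier X"
  shows "C.cls (t \<odot>\<^bsub>XT\<^esub> x) = fst t \<odot>\<^bsub>C.Q\<^esub> C.cls x"
proof -
  have c: "t.pure (snd t) x \<in> carrier t.Te" using t x by (intro t.pure_closed) (auto simp: T_simps)
  then have "C.cls (\<alpha> (t.pure (snd t) x)) = \<zero>\<^bsub>C.Q\<^esub>"
    by (simp add: C.cls_eq_zero_iff \<alpha>_closed) (simp add: im\<alpha>_def)
  then have "C.cls (t \<odot>\<^bsub>XT\<^esub> x) = C.cls (fst t \<odot>\<^bsub>X\<^esub> x) \<oplus>\<^bsub>C.Q\<^esub> \<zero>\<^bsub>C.Q\<^esub>"
    using t x c fst_closed[OF t] by (simp add: XT_smult C.cls_add X.lsmult_closed \<alpha>_closed)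
  also have "\<dots> = C.cls (fst t \<odot>\<^bsub>X\<^esub> x)"
    using t x fst_closed[OF t] by (simp add: C.Q_zero_cls X.lsmult_closed flip: C.cls_add)
  finally show ?thesis using x fst_closed[OF t] by (simp add: C.cls_smult)
qed

lemma cls_hom_T: "C.cls \<in> lmod_hom T XT (inflate C.Q)"
  by (rule lmod_homI) (simp_all add: cls_smult_T C.cls_add lmod_hom_closed[OF C.cls_hom])

lemma hom_cls:
  assumes "h \<in> lmod_hom R C.Q L"
  shows "(\<lambda>x. h (C.cls x)) \<in> lmod_hom T XT (inflate L)"
  using lmod_hom_closed[OF cls_hom_T]
  by (intro lmod_homI) (simp_all add: cls_smult_T C.cls_add fst_closed
      lmod_hom_closed[OF assms] lmod_hom_add[OF assms] lmod_hom_smult[OF assms])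

text \<open>On an inflation \<open>(0, m)\<close> acts as zero, so \<open>f\<close> kills
  \<open>\<alpha> (m \<otimes> x) = (0, m) x\<close> and hence all of
  \<open>im\<alpha>\<close>.\<close>

lemma hom_factor_cls:
  assumes f: "f \<in> lmod_hom T XT (inflate L)" and L: "left_module R L"
  obtains g where "g \<in> lmod_hom R C.Q L" "\<And>x. x \<in> carrier X \<Longrightarrow> g (C.cls x) = f x"
proof -
  interpret L: left_module R L by fact
  have cl: "f x \<in> carrier L" if "x \<in> carrier X" for x using lmod_hom_closed[OF f] that by simp
  have f_add: "f (x \<oplus>\<^bsub>X\<^esub> y) = f x \<oplus>\<^bsub>L\<^esub> f y" if "x \<in> carrier X" "y \<in> carrier X" for x y
    using lmod_hom_add[OF f] that by simp
  have f_smult: "f (t \<odot>\<^bsub>XT\<^esub> x) = fst t \<odot>\<^bsub>L\<^esub> f x" if "t \<in> carrier T" "x \<in> carrier X" for t x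
    using lmod_hom_smult[OF f] that by simp
  have fR: "f \<in> lmod_hom R X L"
    using f_smult[OF emb_closed] by (intro lmod_homI) (simp_all add: cl f_add emb_smult)
  have "f (\<alpha> c) = \<zero>\<^bsub>L\<^esub>" if "c \<in> carrier t.Te" for c
    using that
  proof (induction rule: t.tensor_induct)
    case zero
    then show ?case
      using lmod_hom_zero[OF fR X.M.abelian_group_axioms L.M.abelian_group_axioms]
      by (simp add: \<alpha>_zero)
  next
    case (add a b)
    then show ?case by (simp add: lmod_hom_add[OF \<alpha>_hom] f_add \<alpha>_closed)
  next
    case (minus a)
    then show ?case
      using lmod_hom_minus[OF fR X.M.abelian_group_axioms L.M.abelian_group_axioms]
      by (simp add: \<alpha>_minus \<alpha>_closed)
  next
    case (pure m x)
    then show ?case using f_smult[OF pair_closed] by (simp add: \<alpha>_pure L.lsmult_l_null cl)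
  qed
  then have "f b = \<zero>\<^bsub>L\<^esub>" if "b \<in> im\<alpha>" for b using that by (auto simp: im\<alpha>_def)
  then show thesis using C.quot_universal[OF fR L] that by blast
qed

lemma Gen_coker_iff:
  assumes L: "left_module R L"
  shows "L \<in> Gen R C.Q \<longleftrightarrow> inflate L \<in> Gen T XT"
proof -
  \<comment> \<open>Composition with the surjection \<open>cls\<close> matches the two families of
    homomorphisms without changing their images in \<open>L\<close>, and \<open>Gen_iff\<close>
    depends on these images only.\<close>
  have "(\<forall>h \<in> lmod_hom R C.Q L. h ` carrier C.Q \<subseteq> H)
      \<longleftrightarrow> (\<forall>h \<in> lmod_hom T XT (inflate L). h ` carrier XT \<subseteq> H)" for H
  proof
    assume *: "\<forall>h \<in> lmod_hom R C.Q L. h ` carrier C.Q \<subseteq> H"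
    show "\<forall>h \<in> lmod_hom T XT (inflate L). h ` carrier XT \<subseteq> H"
    proof
      fix h assume "h \<in> lmod_hom T XT (inflate L)"
      then obtain g where g: "g \<in> lmod_hom R C.Q L" "\<And>x. x \<in> carrier X \<Longrightarrow> g (C.cls x) = h x"
        using hom_factor_cls[OF _ L] by blast
      then show "h ` carrier XT \<subseteq> H"
        using bspec[OF * g(1)] by (simp add: C.Q_carrier image_subset_iff g)
    qed
  next
    assume *: "\<forall>h \<in> lmod_hom T XT (inflate L). h ` carrier XT \<subseteq> H"
    show "\<forall>h \<in> lmod_hom R C.Q L. h ` carrier C.Q \<subseteq> H"
      using bspec[OF * hom_cls] by (simp add: C.Q_carrier image_subset_iff)
  qed
  then show ?thesis
    unfolding Gen_iff[OF C.quot_left_module] Gen_iff[OF XT.left_module_axioms] subgroup_inflate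
    using L inflate_left_module[OF L] by simp
qed

end

section \<open>Transfer of presentations, of \<open>D_class\<close>, of \<open>Gen\<close> and of
  torsion classes\<close>

locale presented_module = tensor_ring_module R N X \<alpha> + A: induced_module R N P1
    + B: induced_module R N P0
  for R :: "'r ring" and N :: "('r, 'r, 'n) bimodule" and X :: "('r, 'x) module" and \<alpha>
    and P1 :: "('r, 'p1) module" and P0 :: "('r, 'p0) module" +
  fixes \<delta> \<pi>
  assumes pres: "proj_presentation (tensor_ring R N) (l_obj R N P1) \<delta> (l_obj R N P0) \<pi> (tr_module R N X \<alpha>)"
begin

lemma \<delta>_hom: "\<delta> \<in> lmod_hom T A.lP B.lP"
  and \<pi>_hom: "\<pi> \<in> lmod_hom T B.lP XT"
  and \<pi>_surj: "\<pi> ` carrier B.lP = carrier X"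
  and exact: "\<delta> ` carrier A.lP = {y \<in> carrier B.lP. \<pi> y = \<zero>\<^bsub>X\<^esub>}"
  and proj: "projective_module T A.lP"
  using pres by (simp_all add: proj_presentation_def)

lemma \<pi>_lift:
  assumes "x \<in> carrier X"
  obtains y where "y \<in> carrier B.lP" "\<pi> y = x"
proof -
  have "x \<in> \<pi> ` carrier B.lP" using assms \<pi>_surj by simp
  then show thesis using that by auto
qed

lemma \<delta>_lift:
  assumes "y \<in> carrier B.lP" "\<pi> y = \<zero>\<^bsub>X\<^esub>"
  obtains w where "w \<in> carrier A.lP" "\<delta> w = y"
proof -
  have "y \<in> \<delta> ` carrier A.lP" using assms exact by simp
  then show thesis using that by auto
qed

abbreviation q\<delta> where "q\<delta> \<equiv> q_delta R N P1 P0 \<delta>"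

lemma q\<delta>_unit: "p \<in> carrier P1 \<Longrightarrow> q\<delta> p = B.counit (\<delta> (A.unit p))"
  by (rule q_delta_eq[OF A.induced_module_axioms B.induced_module_axioms \<delta>_hom])

lemma counit_\<delta>_hom: "(\<lambda>y. B.counit (\<delta> y)) \<in> lmod_hom T A.lP (inflate P0)"
  using lmod_hom_closed[OF \<delta>_hom] lmod_hom_closed[OF B.counit_hom]
  by (intro lmod_homI) (simp_all add: lmod_hom_add[OF \<delta>_hom] lmod_hom_smult[OF \<delta>_hom]
      lmod_hom_smult[OF B.counit_hom] B.counit_add)

lemma q\<delta>_hom: "q\<delta> \<in> lmod_hom R P1 P0"
proof -
  note h = A.hom_unit[OF counit_\<delta>_hom]
  show ?thesis
    using lmod_hom_closed[OF h] lmod_hom_add[OF h] lmod_hom_smult[OF h]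
    by (intro lmod_homI) (simp_all add: q\<delta>_unit A.P.lsmult_closed)
qed

text \<open>Naturality of the counit: the left side is a \<open>T\<close>-map into an inflation, so
  it is determined by its values on \<open>unit p\<close>, and these are
  \<open>q\<delta> p\<close>.\<close>

lemma counit_\<delta>: "y \<in> carrier A.lP \<Longrightarrow> B.counit (\<delta> y) = q\<delta> (A.counit y)"
  using A.hom_factor_counit[OF counit_\<delta>_hom B.P.left_module_axioms]
  by (simp add: q\<delta>_unit A.counit_closed)

lemma inflate_in_D_class_iff:
  assumes L: "left_module R L"
  shows "inflate L \<in> D_class T A.lP \<delta> B.lP \<longleftrightarrow> L \<in> D_class R P1 q\<delta> P0"
proof
  assume D: "inflate L \<in> D_class T A.lP \<delta> B.lP"
  show "L \<in> D_class R P1 q\<delta> P0"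
    unfolding D_class_def
  proof (intro CollectI conjI ballI L)
    fix f assume f: "f \<in> lmod_hom R P1 L"
    obtain G where G: "G \<in> lmod_hom T B.lP (inflate L)"
      and Gd: "\<And>y. y \<in> carrier A.lP \<Longrightarrow> G (\<delta> y) = f (A.counit y)"
      using D_classE[OF D A.hom_counit[OF f]] by blast
    \<comment> \<open>\<open>q\<delta> p\<close> is the counit of \<open>\<delta> (unit p)\<close>,
      and \<open>G\<close> does not distinguish an element from the unit of its counit; so the left
      side is \<open>G (\<delta> (unit p)) = f (counit (unit p))\<close>.\<close>
    have "G (B.unit (q\<delta> p)) = f p" if p: "p \<in> carrier P1" for p
      using B.hom_factor_counit[OF G L lmod_hom_closed[OF \<delta>_hom A.unit_closed[OF p]]]
        Gd[OF A.unit_closed[OF p]] p by (simp add: q\<delta>_unit A.counit_unit)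
    then show "\<exists>g\<in>lmod_hom R P0 L. \<forall>p\<in>carrier P1. g (q\<delta> p) = f p"
      by (intro bexI[OF _ B.hom_unit[OF G]]) simp
  qed
next
  assume D: "L \<in> D_class R P1 q\<delta> P0"
  show "inflate L \<in> D_class T A.lP \<delta> B.lP"
    unfolding D_class_def
  proof (intro CollectI conjI ballI inflate_left_module L)
    fix F assume F: "F \<in> lmod_hom T A.lP (inflate L)"
    obtain g where g: "g \<in> lmod_hom R P0 L"
      and gd: "\<And>p. p \<in> carrier P1 \<Longrightarrow> g (q\<delta> p) = F (A.unit p)"
      using D_classE[OF D A.hom_unit[OF F]] by blast
    have "g (B.counit (\<delta> y)) = F y" if y: "y \<in> carrier A.lP" for y
      using A.hom_factor_counit[OF F L y] by (simp add: counit_\<delta> y gd A.counit_closed)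
    then show "\<exists>G\<in>lmod_hom T B.lP (inflate L). \<forall>y\<in>carrier A.lP. G (\<delta> y) = F y"
      by (intro bexI[OF _ B.hom_counit[OF g]]) simp
  qed
qed

lemma cls_\<pi>_hom: "(\<lambda>y. C.cls (\<pi> y)) \<in> lmod_hom T B.lP (inflate C.Q)"
  using lmod_hom_closed[OF \<pi>_hom] lmod_hom_closed[OF cls_hom_T]
  by (intro lmod_homI) (simp_all add: lmod_hom_add[OF \<pi>_hom] lmod_hom_smult[OF \<pi>_hom]
      C.cls_add cls_smult_T)

text \<open>Right exactness of \<open>q\<close>: if \<open>1 \<otimes> p\<close> is sent to \<open>M' X\<close>, then \<open>1 \<otimes> p\<close> lies in
  \<open>im \<delta> + M' l(P0)\<close>, and the counit kills the second summand.\<close>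

lemma coker_presentation:
  assumes "projective_module R P1" "projective_module R P0"
  shows "proj_presentation R P1 q\<delta> P0 (\<lambda>p. C.cls (\<pi> (B.unit p))) C.Q"
proof -
  have \<pi>_cl: "\<pi> y \<in> carrier X" if "y \<in> carrier B.lP" for y
    using lmod_hom_closed[OF \<pi>_hom that] by simp
  have \<pi>_minus: "\<pi> (\<ominus>\<^bsub>B.lP\<^esub> y) = \<ominus>\<^bsub>X\<^esub> \<pi> y" if "y \<in> carrier B.lP" for y
    using lmod_hom_minus[OF \<pi>_hom B.lP.M.abelian_group_axioms XT.M.abelian_group_axioms that]
    by (simp add: XT_minus)
  \<comment> \<open>\<open>cls \<circ> \<pi>\<close> maps into an inflation, so it sees
    \<open>y\<close> only through \<open>counit y\<close>.\<close>
  have factor: "C.cls (\<pi> y) = C.cls (\<pi> (B.unit (B.counit y)))" if "y \<in> carrier B.lP" for y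
    using B.hom_factor_counit[OF cls_\<pi>_hom C.quot_left_module that] .
  \<comment> \<open>Elements of \<open>M' X\<close> lift to \<open>M' l(P0)\<close>; of the latter
    only the vanishing of the counit is recorded.\<close>
  have "\<exists>y\<in>carrier B.lP. \<pi> y = b \<and> B.counit y = \<zero>\<^bsub>P0\<^esub>" if b: "b \<in> im\<alpha>" for b
  proof -
    obtain c where c: "c \<in> carrier t.Te" "b = \<alpha> c" using b by (auto simp: im\<alpha>_def)
    have "\<exists>y\<in>carrier B.lP. \<pi> y = \<alpha> c \<and> B.counit y = \<zero>\<^bsub>P0\<^esub>"
      using c(1)
    proof (induction rule: t.tensor_induct)
      case zero
      then show ?case
        using lmod_hom_zero[OF \<pi>_hom B.lP.M.abelian_group_axioms XT.M.abelian_group_axioms]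
        by (intro bexI[of _ "\<zero>\<^bsub>B.lP\<^esub>"]) (simp_all add: \<alpha>_zero B.counit_zero)
    next
      case (add a b)
      then obtain y z where "y \<in> carrier B.lP" "\<pi> y = \<alpha> a" "B.counit y = \<zero>\<^bsub>P0\<^esub>"
        "z \<in> carrier B.lP" "\<pi> z = \<alpha> b" "B.counit z = \<zero>\<^bsub>P0\<^esub>" by blast
      then show ?case
        using add.hyps by (intro bexI[of _ "y \<oplus>\<^bsub>B.lP\<^esub> z"])
          (simp_all add: lmod_hom_add[OF \<pi>_hom] lmod_hom_add[OF \<alpha>_hom] B.counit_add)
    next
      case (minus a)
      then obtain y where "y \<in> carrier B.lP" "\<pi> y = \<alpha> a" "B.counit y = \<zero>\<^bsub>P0\<^esub>" by blast
      then show ?case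
        using minus.hyps \<pi>_minus[of y]
        by (intro bexI[of _ "\<ominus>\<^bsub>B.lP\<^esub> y"]) (simp_all add: \<alpha>_minus B.counit_minus)
    next
      case (pure m x)
      \<comment> \<open>Any lift of \<open>x\<close>, multiplied by \<open>(0, m)\<close>, lifts
        \<open>(0, m) x\<close>, and its counit vanishes because \<open>(0, m)\<close> has
        augmentation zero.\<close>
      obtain y where y: "y \<in> carrier B.lP" "\<pi> y = x" using \<pi>_lift[OF pure(2)] .
      have "\<pi> ((\<zero>\<^bsub>R\<^esub>, m) \<odot>\<^bsub>B.lP\<^esub> y) = \<alpha> (t.pure m x)"
        using lmod_hom_smult[OF \<pi>_hom pair_closed[OF pure(1)] y(1)] y(2) pure by (simp add: \<alpha>_pure)
      moreover have "B.counit ((\<zero>\<^bsub>R\<^esub>, m) \<odot>\<^bsub>B.lP\<^esub> y) = \<zero>\<^bsub>P0\<^esub>"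
        using lmod_hom_smult[OF B.counit_hom pair_closed[OF pure(1)] y(1)] B.counit_closed[OF y(1)]
        by (simp add: B.P.lsmult_l_null)
      ultimately show ?case
        using B.lP.lsmult_closed[OF pair_closed[OF pure(1)] y(1)] by blast
    qed
    then show ?thesis using c by simp
  qed
  note lift = this
  have "q\<delta> ` carrier P1 = {p \<in> carrier P0. C.cls (\<pi> (B.unit p)) = \<zero>\<^bsub>C.Q\<^esub>}"
  proof (intro equalityI subsetI)
    fix p0 assume "p0 \<in> q\<delta> ` carrier P1"
    then obtain p where p: "p \<in> carrier P1" "p0 = q\<delta> p" by blast
    have d: "\<delta> (A.unit p) \<in> carrier B.lP" using lmod_hom_closed[OF \<delta>_hom A.unit_closed[OF p(1)]] .
    have "\<pi> (\<delta> (A.unit p)) = \<zero>\<^bsub>X\<^esub>" using exact A.unit_closed[OF p(1)] by blast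
    then have "C.cls (\<pi> (B.unit p0)) = \<zero>\<^bsub>C.Q\<^esub>"
      using factor[OF d] p by (simp add: q\<delta>_unit C.Q_zero_cls)
    then show "p0 \<in> {p \<in> carrier P0. C.cls (\<pi> (B.unit p)) = \<zero>\<^bsub>C.Q\<^esub>}"
      using lmod_hom_closed[OF q\<delta>_hom p(1)] p(2) by simp
  next
    fix p assume "p \<in> {p \<in> carrier P0. C.cls (\<pi> (B.unit p)) = \<zero>\<^bsub>C.Q\<^esub>}"
    then have p: "p \<in> carrier P0" and "\<pi> (B.unit p) \<in> im\<alpha>"
      using C.cls_eq_zero_iff \<pi>_cl B.unit_closed by auto
    then obtain y where y: "y \<in> carrier B.lP" "\<pi> y = \<pi> (B.unit p)" "B.counit y = \<zero>\<^bsub>P0\<^esub>"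
      using lift by blast
    \<comment> \<open>Subtracting \<open>y\<close> moves \<open>unit p\<close> into the kernel of
      \<open>\<pi>\<close>, which is the image of \<open>\<delta>\<close>, and leaves its counit
      equal to \<open>p\<close>.\<close>
    let ?z = "B.unit p \<oplus>\<^bsub>B.lP\<^esub> \<ominus>\<^bsub>B.lP\<^esub> y"
    have z: "?z \<in> carrier B.lP" using y B.unit_closed[OF p] by simp
    have z0: "\<pi> ?z = \<zero>\<^bsub>X\<^esub>"
      using y B.unit_closed[OF p] \<pi>_cl[OF B.unit_closed[OF p]]
      by (simp add: lmod_hom_add[OF \<pi>_hom] \<pi>_minus X.M.r_neg)
    obtain w where w: "w \<in> carrier A.lP" "\<delta> w = ?z" using \<delta>_lift[OF z z0] .
    have "B.counit ?z = p"
      using y p B.unit_closed[OF p]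
      by (simp add: B.counit_add B.counit_minus B.counit_unit)
    then have "q\<delta> (A.counit w) = p" using counit_\<delta>[OF w(1)] w(2) by simp
    then show "p \<in> q\<delta> ` carrier P1" using A.counit_closed[OF w(1)] by blast
  qed
  moreover have "(\<lambda>p. C.cls (\<pi> (B.unit p))) ` carrier P0 = carrier C.Q"
  proof -
    have "C.cls x \<in> (\<lambda>p. C.cls (\<pi> (B.unit p))) ` carrier P0" if x: "x \<in> carrier X" for x
    proof -
      obtain y where "y \<in> carrier B.lP" "\<pi> y = x" using \<pi>_lift[OF x] .
      then show ?thesis using factor[of y] B.counit_closed[of y] by blast
    qed
    then show ?thesis using \<pi>_cl[OF B.unit_closed] by (auto simp: C.Q_carrier)
  qed
  ultimately show ?thesis
    using assms q\<delta>_hom B.hom_unit[OF cls_\<pi>_hom] C.quot_left_module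
    by (simp add: proj_presentation_def)
qed

text \<open>Closure of the torsion class under quotients cannot be quoted: it concerns the universe
  \<open>'u\<close>, whereas \<open>X\<close> and its cokernel have carriers in types of their own.
  Projectivity of \<open>l(P1)\<close> gives the closure needed here directly.\<close>

lemma coker_in_D_class:
  assumes X: "XT \<in> D_class T A.lP \<delta> B.lP"
  shows "C.Q \<in> D_class R P1 q\<delta> P0"
  unfolding D_class_def
proof (intro CollectI conjI ballI C.quot_left_module)
  fix f assume f: "f \<in> lmod_hom R P1 C.Q"
  obtain F where F: "F \<in> lmod_hom T A.lP XT"
    and Ff: "\<And>y. y \<in> carrier A.lP \<Longrightarrow> C.cls (F y) = f (A.counit y)"
    using projective_lift[OF proj XT.left_module_axioms inflate_left_module[OF C.quot_left_module]
        cls_hom_T _ A.hom_counit[OF f]] by (auto simp: C.Q_carrier)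
  obtain G where G: "G \<in> lmod_hom T B.lP XT"
    and Gd: "\<And>y. y \<in> carrier A.lP \<Longrightarrow> G (\<delta> y) = F y"
    using D_classE[OF X F] by blast
  \<comment> \<open>Unlike \<open>G\<close>, this composite has an inflation as its target, so its
    restriction along \<open>unit\<close> is an \<open>R\<close>-map out of \<open>P0\<close>, which
    is the required extension.\<close>
  have G': "(\<lambda>y. C.cls (G y)) \<in> lmod_hom T B.lP (inflate C.Q)"
    using lmod_hom_closed[OF G] lmod_hom_closed[OF cls_hom_T]
    by (intro lmod_homI) (simp_all add: lmod_hom_add[OF G] lmod_hom_smult[OF G] C.cls_add cls_smult_T)
  have "C.cls (G (B.unit (q\<delta> p))) = f p" if p: "p \<in> carrier P1" for p
    using B.hom_factor_counit[OF G' C.quot_left_module lmod_hom_closed[OF \<delta>_hom A.unit_closed[OF p]]]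
      Gd[OF A.unit_closed[OF p]] Ff[OF A.unit_closed[OF p]] p
    by (simp add: q\<delta>_unit A.counit_unit)
  then show "\<exists>g\<in>lmod_hom R P0 C.Q. \<forall>p\<in>carrier P1. g (q\<delta> p) = f p"
    by (intro bexI[OF _ B.hom_unit[OF G']]) simp
qed

lemma lmod_hom_inflate: "h \<in> lmod_hom R L L' \<Longrightarrow> h \<in> lmod_hom T (inflate L) (inflate L')"
  by (rule lmod_homI) (simp_all add: lmod_hom_closed lmod_hom_add lmod_hom_smult fst_closed)

lemma torsion_class_coker:
  assumes TC: "torsion_class T (D_class T A.lP \<delta> B.lP :: ('r \<times> (nat \<Rightarrow> 'n list pres), 'u) module set)"
  shows "torsion_class R (D_class R P1 q\<delta> P0 :: ('r, 'u) module set)"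
proof -
  let ?DT = "D_class T A.lP \<delta> B.lP :: ('r \<times> (nat \<Rightarrow> 'n list pres), 'u) module set"
  let ?D = "D_class R P1 q\<delta> P0 :: ('r, 'u) module set"
  have lm: "left_module R L" if "L \<in> ?D" for L using that by (simp add: D_class_def)
  have up: "inflate L \<in> ?DT" if "L \<in> ?D" for L
    using that inflate_in_D_class_iff[OF lm[OF that]] by blast
  have down: "L \<in> ?D" if "left_module R L" "inflate L \<in> ?DT" for L
    using that inflate_in_D_class_iff by blast
  note TC = TC[unfolded torsion_class_def]
  note quot = TC[THEN conjunct2, THEN conjunct1, THEN bspec, THEN spec, THEN spec, THEN mp]
  note ext = TC[THEN conjunct2, THEN conjunct2, THEN conjunct1, THEN bspec, THEN bspec,
      THEN spec, THEN spec, THEN spec, THEN mp]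
  note sum = TC[THEN conjunct2, THEN conjunct2, THEN conjunct2, THEN spec, THEN spec,
      THEN spec, THEN spec, THEN mp]
  show ?thesis
    unfolding torsion_class_def
  proof (intro conjI ballI allI impI; (elim conjE)?)
    show "left_module R L" if "L \<in> ?D" for L using lm[OF that] .
  next
    fix L L' :: "('r, 'u) module" and p
    assume L: "L \<in> ?D" and L': "left_module R L'"
      and p: "p \<in> lmod_hom R L L'" "p ` carrier L = carrier L'"
    have "inflate L' \<in> ?DT"
      using quot[OF up[OF L], of "inflate L'" p] p
      by (simp add: inflate_left_module[OF L'] lmod_hom_inflate)
    with L' show "L' \<in> ?D" by (rule down)
  next
    fix A C B :: "('r, 'u) module" and i p
    assume AC: "A \<in> ?D" "C \<in> ?D" and B: "left_module R B"
      and ip: "i \<in> lmod_hom R A B" "inj_on i (carrier A)"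
        "p \<in> lmod_hom R B C" "p ` carrier B = carrier C"
        "i ` carrier A = {b \<in> carrier B. p b = \<zero>\<^bsub>C\<^esub>}"
    have "inflate B \<in> ?DT"
      using ext[OF up[OF AC(1)] up[OF AC(2)], of "inflate B" i p] ip
      by (simp add: inflate_left_module[OF B] lmod_hom_inflate)
    with B show "B \<in> ?D" by (rule down)
  next
    fix I :: "'u set" and F and L :: "('r, 'u) module" and h
    assume F: "\<forall>i\<in>I. F i \<in> ?D" and L: "left_module R L" and h: "h \<in> lmod_hom R (dsum I F) L"
      "bij_betw h (carrier (dsum I F)) (carrier L)"
    \<comment> \<open>A direct sum of inflations has the elements and addition of the original
      direct sum, with scalars acting through \<open>fst\<close>. So the same index set and the same
      bijection \<open>h\<close> serve over \<open>T\<close>.\<close>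
    have ds: "carrier (dsum I (\<lambda>i. inflate (F i))) = carrier (dsum I F)"
      "add (dsum I (\<lambda>i. inflate (F i))) = add (dsum I F)"
      "t \<odot>\<^bsub>dsum I (\<lambda>i. inflate (F i))\<^esub> f = fst t \<odot>\<^bsub>dsum I F\<^esub> f" for t :: "'r \<times> (nat \<Rightarrow> 'n list pres)" and f
      by (simp_all add: dsum_def)
    have "h \<in> lmod_hom T (dsum I (\<lambda>i. inflate (F i))) (inflate L)"
      by (rule lmod_homI) (simp_all add: ds lmod_hom_closed[OF h(1)] lmod_hom_add[OF h(1)]
          lmod_hom_smult[OF h(1)] fst_closed)
    then have "inflate L \<in> ?DT"
      using F up h(2) sum[of I "\<lambda>i. inflate (F i)" "inflate L" h]
      by (simp add: ds inflate_left_module[OF L])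
    with L show "L \<in> ?D" by (rule down)
  qed
qed

lemma Gen_coker:
  assumes "(Gen T XT :: ('r \<times> (nat \<Rightarrow> 'n list pres), 'u) module set) = D_class T A.lP \<delta> B.lP"
  shows "(Gen R C.Q :: ('r, 'u) module set) = D_class R P1 q\<delta> P0"
proof (rule Set.set_eqI)
  fix L :: "('r, 'u) module"
  show "L \<in> Gen R C.Q \<longleftrightarrow> L \<in> D_class R P1 q\<delta> P0"
  proof (cases "left_module R L")
    case True
    then show ?thesis
      using Gen_coker_iff[OF True] inflate_in_D_class_iff[OF True] assms by simp
  next
    case False
    then show ?thesis by (simp add: Gen_def D_class_def)
  qed
qed

end

theorem corollary4p5:
  fixes R :: "'r ring"
    and N :: "('r, 'r, 'n) bimodule"
    and P0 :: "('r, 'p0) module"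
    and P1 :: "('r, 'p1) module"
    and X :: "('r, 'x) module"
    and \<alpha> :: "((nat \<Rightarrow> 'n list pres) \<times> 'x) pres \<Rightarrow> 'x"
    and \<delta> :: "(('r \<times> (nat \<Rightarrow> 'n list pres)) \<times> 'p1) pres \<Rightarrow> (('r \<times> (nat \<Rightarrow> 'n list pres)) \<times> 'p0) pres"
    and \<pi> :: "(('r \<times> (nat \<Rightarrow> 'n list pres)) \<times> 'p0) pres \<Rightarrow> 'x"
  assumes "ring R" and "\<one>\<^bsub>R\<^esub> \<noteq> \<zero>\<^bsub>R\<^esub>"
    and "bimodule R R N"
    and "projective_module R P0" and "projective_module R P1"
    and "tr_pair R N X \<alpha>"
    and "proj_presentation (tensor_ring R N) (l_obj R N P1) \<delta> (l_obj R N P0) \<pi> (tr_module R N X \<alpha>)"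
  shows "(silting TYPE('u) (tensor_ring R N) (l_obj R N P1) \<delta> (l_obj R N P0) (tr_module R N X \<alpha>)
      \<longrightarrow> silting TYPE('u) R P1 (q_delta R N P1 P0 \<delta>) P0 (coker R N X \<alpha>))
    \<and> (partial_silting TYPE('u) (tensor_ring R N) (l_obj R N P1) \<delta> (l_obj R N P0) (tr_module R N X \<alpha>)
      \<longrightarrow> partial_silting TYPE('u) R P1 (q_delta R N P1 P0 \<delta>) P0 (coker R N X \<alpha>))"
proof -
  \<comment> \<open>Projectivity includes the module axioms, and these include that the scalars form
    a ring; thus the presentation supplies the locale assumptions on \<open>T\<close>,
    \<open>l(P1)\<close> and \<open>l(P0)\<close>.\<close>
  have lm: "left_module (tensor_ring R N) (l_obj R N P1)" "left_module (tensor_ring R N) (l_obj R N P0)"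
    "left_module (tensor_ring R N) (tr_module R N X \<alpha>)" "left_module R P0" "left_module R P1"
    using assms by (simp_all add: proj_presentation_def projective_module_def)
  interpret presented_module R N X \<alpha> P1 P0 \<delta> \<pi>
    using assms lm left_module.axioms(1)[OF lm(1)]
    by (simp add: presented_module_def presented_module_axioms_def tensor_ring_module_def
        tensor_ring_module_axioms_def tensor_ring_over_def induced_module_def tr_pair_def)
  show ?thesis
    using coker_presentation[OF assms(5,4)] Gen_coker coker_in_D_class torsion_class_coker
    unfolding silting_def partial_silting_def coker_eq by blast
qed

end
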